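(* Let $p$ and $q$ be two arbitrary distributions over a finite set $\mathcal X$ with $n^*_{\mathrm{PF}}(p,q,1/4,1/4)\ge2$, and let $\pi\in(0,1/2]$ and $\delta\in(0,\pi/4)$. Write $n^*:=n^*_{\mathrm B}(p,q,\pi,\delta)$. For any integer $D\ge2$ (the communication budget), the following hold. 1. (Statistical cost) $$n^*\lesssim n^*_{\mathrm{B,comm}}(p,q,\pi,\delta,D)\lesssim n^*\max\left(1,\frac{\log(n^*/\pi)}{D}\right).$$ 2. (Computational cost) There exists an algorithm that takes as input $p,q,\pi,\delta$ and $D$, runs in time $\mathrm{poly}(|\mathcal X|,D,\log(1/\pi),\log(1/\delta))$, and outputs a quantizer $\widehat f$ (a channel from $\mathcal X$ to $[D]$) such that the resulting sample complexity $n^*_{\mathrm B}(\widehat f(p),\widehat f(q),\pi,\delta)$ is at most $$n^*\max\left(1,\frac{\log(n^*/\pi)}{D}\right).$$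
   Context: For distributions $p,q$ on a finite domain $\mathcal X$: - $n^*_{\mathrm B}(p,q,\pi,\delta)$ is the smallest $n\in\{0,1,\dots\}$ for which there is $\phi:\mathcal X^n\to\{p,q\}$ with $\pi\,\mathbb P_{X\sim p^{\otimes n}}\{\phi(X)\ne p\}+(1-\pi)\,\mathbb P_{X\sim q^{\otimes n}}\{\phi(X)\ne q\}\le\delta$; - $n^*_{\mathrm{PF}}(p,q,\alpha,\beta)$ is the smallest $n$ for which there is $\phi:\mathcal X^n\to\{p,q\}$ with $\mathbb P_{X\sim p^{\otimes n}}\{\phi(X)\ne p\}\le\alpha$ and $\mathbb P_{X\sim q^{\otimes n}}\{\phi(X)\ne q\}\le\beta$. These are $+\infty$ if no such $n$ exists. Communication-constrained testing: let $\mathcal C$ be the set of all channels (stochastic maps) $f:\mathcal X\to[D]=\{1,\dots,D\}$. Given i.i.d. samples $X_1,\dots,X_n$, each is replaced by $Y_i=f(X_i)$ (with the same $f\in\mathcal C$, the $Y_i$ being generated independently given the $X_i$'s), and a test $\phi$ sees only $Y_1,\dots,Y_n$. $n^*_{\mathrm{B,comm}}(p,q,\pi,\delta,D)$ is the smallest $n$ for which there is a pair $(\phi,f)$ with $f\in\mathcal C$ and $$\pi\,\mathbb P_{X\sim p^{\otimes n}}\{\phi(Y_1,\dots,Y_n)\ne p\}+(1-\pi)\,\mathbb P_{X\sim q^{\otimes n}}\{\phi(Y_1,\dots,Y_n)\ne q\}\le\delta.$$ For a channel $f$, $f(p)$ denotes the distribution of $f(X)$ when $X\sim p$; the sample complexity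 resulting from the choice of channel $f$ is $n^*_{\mathrm B}(f(p),f(q),\pi,\delta)$. $A\lesssim B$ means $A\le CB$ for an absolute constant $C>0$. Logarithms are natural.
   Formalization: In part 2 the bound on the resulting sample complexity is proved up to an absolute constant factor (≲, as in part 1); with constant exactly 1 it is false, e.g. p=(.6,.35,.05), q=(.03,.3,.67), π=1/2, D=2, δ=.0933. Running time counts exact real-arithmetic steps. *)

theory Defs
  imports "HOL-Probability.Probability"
begin

section \<open>Simple binary hypothesis testing\<close>

text \<open>
  A test returns a label rather than a distribution, so that the two error events stay distinct
  when the two distributions coincide (as happens for \<open>f(p)\<close> and \<open>f(q)\<close> when the
  channel \<open>f\<close> is uninformative).
\<close>

datatype hypothesis = Hyp_p | Hyp_q

definition err_p :: "'a list pmf \<Rightarrow> ('a list \<Rightarrow> hypothesis) \<Rightarrow> real" where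
  "err_p P \<phi> = measure_pmf.prob P {x. \<phi> x \<noteq> Hyp_p}"

definition err_q :: "'a list pmf \<Rightarrow> ('a list \<Rightarrow> hypothesis) \<Rightarrow> real" where
  "err_q Q \<phi> = measure_pmf.prob Q {x. \<phi> x \<noteq> Hyp_q}"

definition bayes_err ::
    "real \<Rightarrow> 'a list pmf \<Rightarrow> 'a list pmf \<Rightarrow> ('a list \<Rightarrow> hypothesis) \<Rightarrow> real" where
  "bayes_err \<pi> P Q \<phi> = \<pi> * err_p P \<phi> + (1 - \<pi>) * err_q Q \<phi>"

text \<open>
  The infimum in \<^typ>\<open>enat\<close> of a nonempty set is its least element, and that of the empty set
  is \<open>\<infinity>\<close>.
\<close>

definition n_B :: "'a pmf \<Rightarrow> 'a pmf \<Rightarrow> real \<Rightarrow> real \<Rightarrow> enat" where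
  "n_B p q \<pi> \<delta> =
     Inf {enat n | n. \<exists>\<phi>. bayes_err \<pi> (replicate_pmf n p) (replicate_pmf n q) \<phi> \<le> \<delta>}"

definition n_PF :: "'a pmf \<Rightarrow> 'a pmf \<Rightarrow> real \<Rightarrow> real \<Rightarrow> enat" where
  "n_PF p q \<alpha> \<beta> =
     Inf {enat n | n. \<exists>\<phi>. err_p (replicate_pmf n p) \<phi> \<le> \<alpha> \<and> err_q (replicate_pmf n q) \<phi> \<le> \<beta>}"


section \<open>Communication constraints\<close>

definition channels :: "'a set \<Rightarrow> nat \<Rightarrow> ('a \<Rightarrow> nat pmf) set" where
  "channels X D = {f. \<forall>x\<in>X. set_pmf (f x) \<subseteq> {1..D}}"

text \<open>The law of \<open>Y\<^sub>1, \<dots>, Y\<^sub>n\<close> conditionally on \<open>X\<^sub>1, \<dots>, X\<^sub>n\<close>.\<close>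

primrec transmit :: "('a \<Rightarrow> 'b pmf) \<Rightarrow> 'a list \<Rightarrow> 'b list pmf" where
  "transmit f [] = return_pmf []"
| "transmit f (x # xs) =
     bind_pmf (f x) (\<lambda>y. bind_pmf (transmit f xs) (\<lambda>ys. return_pmf (y # ys)))"

definition n_B_comm ::
    "'a set \<Rightarrow> 'a pmf \<Rightarrow> 'a pmf \<Rightarrow> real \<Rightarrow> real \<Rightarrow> nat \<Rightarrow> enat" where
  "n_B_comm X p q \<pi> \<delta> D =
     Inf {enat n | n. \<exists>\<phi>. \<exists>f\<in>channels X D.
            bayes_err \<pi> (bind_pmf (replicate_pmf n p) (transmit f))
                        (bind_pmf (replicate_pmf n q) (transmit f)) \<phi> \<le> \<delta>}"

text \<open>The quantity \<open>N max(1, log(N/\<pi>)/D)\<close>, with value \<open>\<infinity>\<close> at \<open>N = \<infinity>\<close>.\<close>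

definition comm_bound :: "enat \<Rightarrow> real \<Rightarrow> nat \<Rightarrow> ereal" where
  "comm_bound N \<pi> D =
     (case N of enat n \<Rightarrow> ereal (real n * max 1 (ln (real n / \<pi>) / real D)) | \<infinity> \<Rightarrow> \<infinity>)"


section \<open>Algorithms on real inputs\<close>

text \<open>
  The model is the real RAM without transcendental operations: a program handles natural numbers
  (for counting and addressing) and exact reals, in separate arrays, at unit cost. There is no
  multiplication of naturals and no passage from reals to naturals other than by comparing reals
  (in particular no floor function), so that unit cost cannot be abused by packing data into one
  number. Real constants are rational. Each array has one cell for every natural number; a program
  mentions finitely many arrays, and a scalar is cell \<open>0\<close> of an array. Real division by \<open>0\<close>
  gives \<open>0\<close>.
\<close>

record store =
  nats :: "string \<Rightarrow> nat \<Rightarrow> nat"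
  reals :: "string \<Rightarrow> nat \<Rightarrow> real"

datatype nexp =
    NConst nat
  | NGet string nexp
  | NAdd nexp nexp
  | NSub nexp nexp

datatype rexp =
    RConst rat
  | RGet string nexp
  | RAdd rexp rexp
  | RSub rexp rexp
  | RMul rexp rexp
  | RDiv rexp rexp

datatype bexp =
    NLess nexp nexp
  | RLess rexp rexp
  | Not bexp
  | And bexp bexp

datatype program =
    Skip
  | NSet string nexp nexp
  | RSet string nexp rexp
  | Seq program program
  | If bexp program program
  | While bexp program

primrec nval :: "nexp \<Rightarrow> store \<Rightarrow> nat" where
  "nval (NConst n) s = n"
| "nval (NGet A i) s = nats s A (nval i s)"
| "nval (NAdd a b) s = nval a s + nval b s"
| "nval (NSub a b) s = nval a s - nval b s"

primrec rval :: "rexp \<Rightarrow> store \<Rightarrow> real" where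
  "rval (RConst c) s = of_rat c"
| "rval (RGet A i) s = reals s A (nval i s)"
| "rval (RAdd a b) s = rval a s + rval b s"
| "rval (RSub a b) s = rval a s - rval b s"
| "rval (RMul a b) s = rval a s * rval b s"
| "rval (RDiv a b) s = rval a s / rval b s"

primrec bval :: "bexp \<Rightarrow> store \<Rightarrow> bool" where
  "bval (NLess a b) s = (nval a s < nval b s)"
| "bval (RLess a b) s = (rval a s < rval b s)"
| "bval (Not b) s = (\<not> bval b s)"
| "bval (And a b) s = (bval a s \<and> bval b s)"

definition nset :: "string \<Rightarrow> nat \<Rightarrow> nat \<Rightarrow> store \<Rightarrow> store" where
  "nset A i v s = s\<lparr>nats := (nats s)(A := (nats s A)(i := v))\<rparr>"

definition rset :: "string \<Rightarrow> nat \<Rightarrow> real \<Rightarrow> store \<Rightarrow> store" where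
  "rset A i v s = s\<lparr>reals := (reals s)(A := (reals s A)(i := v))\<rparr>"

text \<open>
  \<open>run c s t s'\<close>: started in \<open>s\<close>, program \<open>c\<close> halts in \<open>s'\<close> after \<open>t\<close> steps, an assignment or
  a test counting as one step. The expressions occurring in a program have fixed size, so charging
  for each operation inside them would change \<open>t\<close> by at most a factor depending only on \<open>c\<close>.
\<close>

inductive run :: "program \<Rightarrow> store \<Rightarrow> nat \<Rightarrow> store \<Rightarrow> bool" where
  Skip: "run Skip s 1 s"
| NSet: "run (NSet A i e) s 1 (nset A (nval i s) (nval e s) s)"
| RSet: "run (RSet A i e) s 1 (rset A (nval i s) (rval e s) s)"
| Seq: "run c1 s t1 s1 \<Longrightarrow> run c2 s1 t2 s2 \<Longrightarrow> run (Seq c1 c2) s (t1 + t2) s2"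
| IfTrue: "bval b s \<Longrightarrow> run c1 s t s' \<Longrightarrow> run (If b c1 c2) s (1 + t) s'"
| IfFalse: "\<not> bval b s \<Longrightarrow> run c2 s t s' \<Longrightarrow> run (If b c1 c2) s (1 + t) s'"
| WhileFalse: "\<not> bval b s \<Longrightarrow> run (While b c) s 1 s"
| WhileTrue: "bval b s \<Longrightarrow> run c s t1 s1 \<Longrightarrow> run (While b c) s1 t2 s2 \<Longrightarrow>
    run (While b c) s (1 + t1 + t2) s2"

text \<open>The domain is \<open>{0, \<dots>, k - 1}\<close>, so that \<open>p\<close> and \<open>q\<close> are given by \<open>k\<close> reals each.\<close>

definition input_store ::
    "nat \<Rightarrow> nat pmf \<Rightarrow> nat pmf \<Rightarrow> real \<Rightarrow> real \<Rightarrow> nat \<Rightarrow> store" where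
  "input_store k p q \<pi> \<delta> D =
     \<lparr>nats = (\<lambda>_ _. 0)
        (''k'' := (\<lambda>_. 0)(0 := k),
         ''D'' := (\<lambda>_. 0)(0 := D)),
      reals = (\<lambda>_ _. 0)
        (''p'' := (\<lambda>i. if i < k then pmf p i else 0),
         ''q'' := (\<lambda>i. if i < k then pmf q i else 0),
         ''pi'' := (\<lambda>_. 0)(0 := \<pi>),
         ''delta'' := (\<lambda>_. 0)(0 := \<delta>))\<rparr>"

text \<open>A store outputs a channel as a row-major matrix of transition probabilities.\<close>

definition outputs_channel :: "nat \<Rightarrow> nat \<Rightarrow> store \<Rightarrow> (nat \<Rightarrow> nat pmf) \<Rightarrow> bool" where
  "outputs_channel k D s f \<longleftrightarrow>
     f \<in> channels {..<k} D \<and>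
     (\<forall>x<k. \<forall>y\<in>{1..D}. reals s ''f'' (x * D + (y - 1)) = pmf (f x) y)"

end

(*
  Let u = delta/pi and let M >= 1 be the least integer with u^M <= pi. With lambda = 1/(2M), both n_B(p,q)
  and n_B(f(p),f(q)) are governed by the skewed gap h(p,q) = 1 - sum_x p(x)^(1-lambda) q(x)^lambda:
  n = C ln(1/u)/h samples suffice by the Chernoff bound, and n >= c ln(1/u)/h are necessary by data
  processing. So a quantizer only has to keep a fraction 1/max(1, ln(n/pi)/D) of h.

  As a function of the likelihood ratio r = q/p, the contribution of a point to h is, up to constants,
  lambda times (p-q)^2/(p+q) if r > 1/2, and lambda times p l with l = min(M, floor(log2(1/r))) otherwise.
  These scores are computable without logarithms, and lambda has dropped out. Merging points whose
  (signed) scores per unit mass agree up to a constant factor loses only a constant factor of h, and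
  O(ln(n/pi)) such merged buckets carry half of the total score. Hence D - 1 rounds of greedily choosing
  the best bucket among the unlabelled points are enough, and the remaining points share one last label.
*)
theory Submission
  imports Defs
begin

section \<open>The skewed affinity gap\<close>

text \<open>The exponent lambda = 1/(2M) is chosen so that the prior drops out of the rate. The
  Chernoff test with affinity power u^2 has error at most \<pi>^(1-lambda) u^2, and this is at most
  \<delta> = \<pi> u once u <= \<pi>^lambda, which u^M <= \<pi> gives with a square root to spare.
  Conversely a good test has q-error at most 2 \<delta>, and \<delta> < u^M turns the lambda-th
  power of that into a fixed power of u.

  The linear terms in \<open>skew_gap\<close> split h into nonnegative AM-GM deficits, so each cell
  of a quantizer can be bounded alone and a cell without structure can be discarded.

  The program knows neither n nor the number of relevant scales. Greedy choice makes this harmless: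
  in every round it gains at least as much as the best remaining class of any partition into subsets
  of buckets, and such a partition occurs only in the analysis. There, classes are a sign together
  with a dyadic scale. The total score is at least of order 1/n, so scales below order 1/sqrt(n)
  carry at most half of it, and the M levels occupy only about log M scales; this is the origin of
  ln(n/\<pi>).\<close>

definition skew_gap :: "real \<Rightarrow> real \<Rightarrow> real \<Rightarrow> real" where
  "skew_gap l p q = (1 - l) * p + l * q - p powr (1 - l) * q powr l"

lemma weighted_AM_GM:
  fixes a b l :: real
  assumes "0 \<le> a" "0 \<le> b" "0 \<le> l" "l \<le> 1"
  shows "a powr (1 - l) * b powr l \<le> (1 - l) * a + l * b"
proof (cases "a = 0 \<or> b = 0")
  case True
  \<comment> \<open>\<open>0 powr x\<close> is 0 for every x, including x = 0, so the left side
    vanishes.\<close>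
  then show ?thesis using assms by auto
next
  case False
  then show ?thesis
    using Youngs_inequality_0[of "1 - l" l a b] assms by auto
qed

lemma skew_gap_nonneg: "0 \<le> a \<Longrightarrow> 0 \<le> b \<Longrightarrow> 0 \<le> l \<Longrightarrow> l \<le> 1 \<Longrightarrow> 0 \<le> skew_gap l a b"
  using weighted_AM_GM[of a b l] by (simp add: skew_gap_def)

text \<open>After dividing both families by their sums, the inequality is the sum of the termwise
  weighted AM-GM inequalities. If a sum vanishes, so does every product.\<close>

lemma Holder_powr_sum:
  fixes a b :: "'a \<Rightarrow> real"
  assumes A: "finite A" and ab: "\<And>x. x \<in> A \<Longrightarrow> 0 \<le> a x" "\<And>x. x \<in> A \<Longrightarrow> 0 \<le> b x"
    and l: "0 < l" "l < 1"
  shows "(\<Sum>x\<in>A. a x powr (1 - l) * b x powr l) \<le> sum a A powr (1 - l) * sum b A powr l"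
proof (cases "sum a A = 0 \<or> sum b A = 0")
  case True
  then have "a x powr (1 - l) * b x powr l = 0" if "x \<in> A" for x
    using that A ab by (auto simp: sum_nonneg_eq_0_iff)
  then show ?thesis by (simp add: sum.neutral)
next
  case False
  define SA SB where "SA = sum a A" and "SB = sum b A"
  have pos: "SA > 0" "SB > 0"
    using False ab by (auto simp: SA_def SB_def less_le intro!: sum_nonneg)
  have "a x powr (1 - l) * b x powr l
      \<le> (SA powr (1 - l) * SB powr l) * ((1 - l) * (a x / SA) + l * (b x / SB))" if "x \<in> A" for x
  proof -
    have "(a x / SA) powr (1 - l) * (b x / SB) powr l \<le> (1 - l) * (a x / SA) + l * (b x / SB)"
      using ab that pos l by (intro weighted_AM_GM) auto
    moreover have "(a x / SA) powr (1 - l) * (b x / SB) powr l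
        = a x powr (1 - l) * b x powr l / (SA powr (1 - l) * SB powr l)"
      using ab that pos by (simp add: powr_divide)
    ultimately show ?thesis using pos by (simp add: divide_le_eq mult.commute)
  qed
  then have "(\<Sum>x\<in>A. a x powr (1 - l) * b x powr l)
      \<le> (\<Sum>x\<in>A. (SA powr (1 - l) * SB powr l) * ((1 - l) * (a x / SA) + l * (b x / SB)))"
    by (rule sum_mono)
  also have "\<dots> = (SA powr (1 - l) * SB powr l) * ((1 - l) * (SA / SA) + l * (SB / SB))"
    by (simp add: sum_distrib_left[symmetric] sum.distrib sum_divide_distrib[symmetric]
        SA_def[symmetric] SB_def[symmetric])
  also have "\<dots> = SA powr (1 - l) * SB powr l" using pos by simp
  finally show ?thesis by (simp add: SA_def SB_def)
qed

text \<open>Weighted AM-GM bounds the skewed affinity by the one with exponent \<open>1/2\<close>.\<close>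

lemma skew_gap_ge_square:
  fixes p q l :: real
  assumes "0 \<le> p" "0 \<le> q" "0 < l" "l \<le> 1/2"
  shows "l / 2 * ((p - q)\<^sup>2 / (p + q)) \<le> skew_gap l p q"
proof (cases "p + q = 0")
  case True
  then show ?thesis using assms skew_gap_nonneg[of p q l] by simp
next
  case False
  then have pq: "p + q > 0" using assms by linarith
  define r t where "r = sqrt p" and "t = sqrt q"
  have rt: "p = r\<^sup>2" "q = t\<^sup>2" "r \<ge> 0" "t \<ge> 0" using assms by (auto simp: r_def t_def)
  have "p powr (1 - l) * q powr l = p powr (1 - 2 * l) * (r * t) powr (2 * l)"
  proof (cases "p = 0 \<or> q = 0")
    case True
    then show ?thesis using assms rt by auto
  next
    case False
    then have "r > 0" "t > 0" "p > 0" "q > 0" using assms by (auto simp: r_def t_def)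
    then show ?thesis
      unfolding r_def t_def
      by (simp add: powr_mult powr_half_sqrt[symmetric] powr_powr powr_add[symmetric] mult.assoc[symmetric])
  qed
  also have "\<dots> \<le> (1 - 2 * l) * p + 2 * l * (r * t)"
    using assms rt by (intro weighted_AM_GM) auto
  \<comment> \<open>The two bounds differ by l (p + q - 2 sqrt(p q)), that is, l times the squared
    Hellinger term.\<close>
  finally have "l * (r - t)\<^sup>2 \<le> skew_gap l p q"
    by (simp add: skew_gap_def rt(1,2)) (simp add: algebra_simps power2_eq_square)
  moreover have "(p - q)\<^sup>2 / (p + q) / 2 \<le> (r - t)\<^sup>2"
  proof -
    have "(p - q)\<^sup>2 = (r - t)\<^sup>2 * (r + t)\<^sup>2"
      by (simp add: rt(1,2)) (simp add: algebra_simps power2_eq_square)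
    moreover have "(r + t)\<^sup>2 \<le> 2 * (p + q)"
      using zero_le_power2[of "r - t"] by (simp add: rt(1,2) power2_eq_square algebra_simps)
    ultimately have "(p - q)\<^sup>2 \<le> (r - t)\<^sup>2 * (2 * (p + q))" by (simp add: mult_left_mono)
    then show ?thesis using pq by (simp add: field_simps)
  qed
  ultimately have "l * ((p - q)\<^sup>2 / (p + q) / 2) \<le> skew_gap l p q"
    using assms mult_left_mono[of "(p - q)\<^sup>2 / (p + q) / 2" "(r - t)\<^sup>2" l] by linarith
  then show ?thesis by (simp add: distrib_left mult.commute)
qed

text \<open>Since 2 l k = k/m is at most 1, the chord of an exponential bounds 2^(-l k) by 1 - 2 l k
  (1 - sqrt(1/2)). The resulting gain of about 0.58 k l p must pay for the linear loss l p, which it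
  does only from k = 2 on, leaving k l p / 12. At k = 1 the square bound takes over: there (p - q)^2
  / (p + q) is at least p/6, which again yields 1/12.\<close>

lemma skew_gap_ge_level:
  fixes p q :: real and m k :: nat
  assumes "0 \<le> p" "0 \<le> q" "1 \<le> k" "k \<le> m" "2 ^ k * q \<le> p"
  shows "1 / (2 * real m) * (real k * p) / 12 \<le> skew_gap (1 / (2 * real m)) p q"
proof -
  define l where "l = 1 / (2 * real m)"
  have l: "0 < l" "l \<le> 1/2" using assms by (auto simp: l_def field_simps)
  have lk: "2 * l * real k \<le> 1" "0 \<le> 2 * l * real k" using assms by (auto simp: l_def field_simps)
  have "l * (real k * p) / 12 \<le> skew_gap l p q"
  proof (cases "p = 0")
    case True
    then show ?thesis using skew_gap_nonneg[of p q l] l assms by simp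
  next
    case False
    then have p: "p > 0" using assms by simp
    show ?thesis
    proof (cases "k = 1")
      case True
      then have q: "2 * q \<le> p" using assms by simp
      have "p / 6 \<le> (p - q)\<^sup>2 / (p + q)"
      proof -
        have "p * (p + q) \<le> 6 * (p - q)\<^sup>2"
        proof -
          have "(p/2)\<^sup>2 \<le> (p - q)\<^sup>2" using q p by (intro power_mono) auto
          moreover have "p * (p + q) \<le> p * (3/2 * p)" using p q by (intro mult_left_mono) auto
          ultimately show ?thesis by (simp add: power2_eq_square)
        qed
        then show ?thesis using p assms by (simp add: field_simps)
      qed
      then have "l / 2 * (p / 6) \<le> l / 2 * ((p - q)\<^sup>2 / (p + q))"
        using l by (intro mult_left_mono) auto
      then have "l / 2 * (p / 6) \<le> skew_gap l p q"
        using skew_gap_ge_square[of p q l] l assms(1,2) by linarith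
      then show ?thesis using True by simp
    next
      case False
      then have k2: "k \<ge> 2" using assms by simp
      have "q \<le> p * (1/2) ^ k" using assms(5) by (simp add: field_simps)
      then have "q powr l \<le> (p * (1/2) ^ k) powr l" using assms(2) l(1) by (intro powr_mono2) auto
      also have "\<dots> = p powr l * (sqrt (1/2)) powr (2 * l * real k)"
        using p by (simp add: powr_mult powr_half_sqrt[symmetric] powr_powr powr_realpow[symmetric] mult.commute)
      also have "(sqrt (1/2)) powr (2 * l * real k) \<le> 1 - 2 * l * real k * (1 - sqrt (1/2))"
        using weighted_AM_GM[of 1 "sqrt (1/2)" "2 * l * real k"] lk by (simp add: algebra_simps)
      also have "\<dots> \<le> 1 - 2 * l * real k * (1464/5000)"
      proof -
        have "sqrt (1/2) \<le> 3536/5000" by (rule real_le_lsqrt) (auto simp: power2_eq_square)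
        then have "2 * l * real k * (1464/5000) \<le> 2 * l * real k * (1 - sqrt (1/2))"
          using lk by (intro mult_left_mono) auto
        then show ?thesis by simp
      qed
      finally have "q powr l \<le> p powr l * (1 - 2 * l * real k * (1464/5000))"
        by (simp add: mult_left_mono)
      then have "p powr (1 - l) * q powr l
          \<le> p powr (1 - l) * (p powr l * (1 - 2 * l * real k * (1464/5000)))"
        by (intro mult_left_mono) auto
      also have "\<dots> = p * (1 - 2 * l * real k * (1464/5000))"
        using p by (simp add: mult.assoc[symmetric] powr_add[symmetric])
      finally have "skew_gap l p q \<ge> p * l * (2928/5000 * real k - 1) + l * q"
        by (simp add: skew_gap_def algebra_simps)
      moreover have "p * l * (real k / 12) \<le> p * l * (2928/5000 * real k - 1)"
      proof (intro mult_left_mono)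
        have "real k \<ge> 2" using k2 by simp
        then show "real k / 12 \<le> 2928/5000 * real k - 1" by linarith
      qed (use p l in auto)
      moreover have "0 \<le> l * q" using l(1) assms(2) by simp
      ultimately have "p * l * (real k / 12) \<le> skew_gap l p q" by linarith
      then show ?thesis by (simp add: mult.commute mult.left_commute)
    qed
  qed
  then show ?thesis by (simp add: l_def)
qed

text \<open>Convexity of exp bounds the gap by l times the generalised Kullback-Leibler divergence q
  - p - p ln(q/p), and ln x <= x - 1 bounds that by (q - p)^2 / q. The factor 3 is p + q <= 3
  q.\<close>

lemma skew_gap_le_square:
  fixes p q l :: real
  assumes "0 \<le> p" "0 \<le> q" "0 < l" "l \<le> 1/2" "p \<le> 2 * q"
  shows "skew_gap l p q \<le> 3 * l * ((q - p)\<^sup>2 / (p + q))"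
proof (cases "p = 0")
  case True
  have "q\<^sup>2 / q = q" by (simp add: power2_eq_square)
  then show ?thesis using True assms by (simp add: skew_gap_def)
next
  case False
  then have p: "p > 0" and q: "q > 0" using assms by auto
  have "p powr (1 - l) * q powr l = p * exp (l * ln (q / p))"
    using p q by (simp add: powr_def exp_add[symmetric] exp_diff ln_div algebra_simps exp_minus)
  also have "\<dots> \<ge> p * (1 + l * ln (q / p))"
    using p exp_ge_add_one_self by (intro mult_left_mono) auto
  finally have "skew_gap l p q \<le> l * (q - p - p * ln (q / p))"
    by (simp add: skew_gap_def algebra_simps)
  also have "ln (q / p) \<ge> 1 - p / q"
    using ln_le_minus_one[of "p / q"] p q by (simp add: ln_div)
  then have "l * (q - p - p * ln (q / p)) \<le> l * (q - p - p * (1 - p / q))"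
    using p assms by (intro mult_left_mono diff_left_mono) auto
  also have "\<dots> = l * ((q - p)\<^sup>2 / q)" using q by (simp add: field_simps power2_eq_square)
  also have "l * ((q - p)\<^sup>2 / q) \<le> l * (3 * ((q - p)\<^sup>2 / (p + q)))"
  proof (intro mult_left_mono)
    have "(q - p)\<^sup>2 * (p + q) \<le> (q - p)\<^sup>2 * (3 * q)" using assms by (intro mult_left_mono) auto
    then show "(q - p)\<^sup>2 / q \<le> 3 * ((q - p)\<^sup>2 / (p + q))" using p q by (simp add: field_simps)
  qed (use assms in auto)
  finally show ?thesis by (simp add: mult.assoc mult.left_commute)
qed

text \<open>Below the cap the divergence bound gives p ln(p/q) < (k + 1) p ln 2 <= 2 k p. At the cap
  the ratio p/q may be arbitrarily large, but the gap never exceeds p, and p = l (2 m p) for l =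
  1/(2m). This is why levels beyond m need not be distinguished.\<close>

lemma skew_gap_le_level:
  fixes p q :: real and m k :: nat
  assumes "0 \<le> p" "0 \<le> q" "1 \<le> k" "k \<le> m" "2 * q \<le> p" "p < 2 ^ (k + 1) * q \<or> k = m"
  shows "skew_gap (1 / (2 * real m)) p q \<le> 1 / (2 * real m) * (2 * real k * p)"
proof (cases "k = m")
  case True
  define l where "l = 1 / (2 * real m)"
  have l: "0 < l" "l \<le> 1/2" using assms by (auto simp: l_def field_simps)
  have "l * q \<le> l * p" using l(1) assms(1,2,5) by (intro mult_left_mono) auto
  moreover have "0 \<le> p powr (1 - l) * q powr l" by simp
  ultimately have "skew_gap l p q \<le> p"
    unfolding skew_gap_def left_diff_distrib by linarith
  also have "p = l * (2 * real k * p)" using assms(3) True by (simp add: l_def)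
  finally show ?thesis by (simp add: l_def)
next
  case False
  define l where "l = 1 / (2 * real m)"
  have l: "0 < l" "l \<le> 1/2" using assms by (auto simp: l_def field_simps)
  have lt: "p < 2 ^ (k + 1) * q" using False assms by simp
  then have q: "q > 0" using assms by (metis less_le mult_zero_right not_less)
  then have p: "p > 0" using assms by linarith
  have "p powr (1 - l) * q powr l = p * exp (l * ln (q / p))"
    using p q by (simp add: powr_def exp_add[symmetric] exp_diff ln_div algebra_simps exp_minus)
  also have "\<dots> \<ge> p * (1 + l * ln (q / p))"
    using p exp_ge_add_one_self by (intro mult_left_mono) auto
  finally have "skew_gap l p q \<le> l * (q - p - p * ln (q / p))"
    by (simp add: skew_gap_def algebra_simps)
  also have "\<dots> \<le> l * (p * (2 * real k))"
  proof (intro mult_left_mono)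
    have "ln (p / q) \<le> ln (2 ^ (k + 1))"
      using p q lt by (intro iffD2[OF ln_le_cancel_iff]) (auto simp: field_simps)
    also have "\<dots> = real (k + 1) * ln 2" by (simp only: ln_realpow)
    also have "\<dots> \<le> real (k + 1) * 1" using ln_2_less_1 by (intro mult_left_mono) auto
    also have "\<dots> \<le> 2 * real k" using assms by simp
    finally have "- ln (q / p) \<le> 2 * real k" using p q by (simp add: ln_div)
    then have "p * (- ln (q / p)) \<le> p * (2 * real k)" using p by (intro mult_left_mono) auto
    then show "q - p - p * ln (q / p) \<le> p * (2 * real k)" using assms p by simp
  qed (use l in auto)
  finally show ?thesis by (simp add: l_def mult.commute mult.left_commute)
qed

section \<open>Tests, channels and affinities\<close>

text \<open>The Chernoff coefficient of order \<open>l\<close>. The set \<open>A\<close> is a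
  parameter so that it can be any finite set containing both supports.\<close>

definition affinity :: "real \<Rightarrow> 'a set \<Rightarrow> 'a pmf \<Rightarrow> 'a pmf \<Rightarrow> real" where
  "affinity l A p q = (\<Sum>x\<in>A. pmf p x powr (1 - l) * pmf q x powr l)"

abbreviation lists_len :: "'a set \<Rightarrow> nat \<Rightarrow> 'a list set" where
  "lists_len A n \<equiv> {xs. set xs \<subseteq> A \<and> length xs = n}"

lemma set_replicate_pmf_subset: "set_pmf p \<subseteq> A \<Longrightarrow> set_pmf (replicate_pmf n p) \<subseteq> lists_len A n"
  by (auto simp: set_replicate_pmf)

lemma pmf_replicate_pmf:
  "length xs = n \<Longrightarrow> pmf (replicate_pmf n p) xs = prod_list (map (pmf p) xs)"
proof (induction n arbitrary: xs)
  case (Suc n)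
  then obtain y ys where xs: "xs = y # ys" "length ys = n" by (auto simp: length_Suc_conv)
  have "replicate_pmf (Suc n) p = map_pmf (\<lambda>(x, zs). x # zs) (pair_pmf p (replicate_pmf n p))"
    by (simp add: pair_pmf_def map_bind_pmf)
  then have "pmf (replicate_pmf (Suc n) p) xs
      = pmf (map_pmf (\<lambda>(x, zs). x # zs) (pair_pmf p (replicate_pmf n p))) ((\<lambda>(x, zs). x # zs) (y, ys))"
    using xs by simp
  also have "\<dots> = pmf (pair_pmf p (replicate_pmf n p)) (y, ys)"
    by (rule pmf_map_inj') (auto simp: inj_on_def)
  finally show ?case using xs Suc.IH by (simp add: pmf_pair)
qed simp

lemma sum_prod_list_lists_len:
  fixes f :: "'a \<Rightarrow> real"
  assumes "finite A"
  shows "(\<Sum>xs\<in>lists_len A n. prod_list (map f xs)) = sum f A ^ n"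
proof (induction n)
  case 0
  have "lists_len A 0 = {[]}" by auto
  then show ?case by simp
next
  case (Suc n)
  have "(\<Sum>xs\<in>lists_len A (Suc n). prod_list (map f xs))
      = (\<Sum>(xs, x)\<in>lists_len A n \<times> A. f x * prod_list (map f xs))"
    unfolding lists_length_Suc_eq
    by (subst sum.reindex) (auto simp: inj_on_def intro!: sum.cong)
  also have "\<dots> = (\<Sum>xs\<in>lists_len A n. \<Sum>x\<in>A. f x * prod_list (map f xs))"
    using assms by (simp add: sum.cartesian_product)
  also have "\<dots> = sum f A * (\<Sum>xs\<in>lists_len A n. prod_list (map f xs))"
    by (simp add: sum_distrib_right[symmetric] sum_distrib_left)
  finally show ?case using Suc.IH by simp
qed

lemma prod_list_powr:
  fixes f :: "'a \<Rightarrow> real"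
  shows "(\<And>x. x \<in> set xs \<Longrightarrow> 0 \<le> f x) \<Longrightarrow> prod_list (map f xs) powr l = prod_list (map (\<lambda>x. f x powr l) xs)"
proof (induction xs)
  case (Cons y ys)
  have "0 \<le> prod_list (map f ys)"
    using Cons.prems by (intro prod_list_nonneg) auto
  then show ?case using Cons by (simp add: powr_mult)
qed simp

text \<open>Tensorisation: densities of independent samples factor, and so does the sum over words.
  It makes the one-sample gap the rate per sample.\<close>

lemma affinity_replicate:
  assumes "finite A"
  shows "affinity l (lists_len A n) (replicate_pmf n p) (replicate_pmf n q) = affinity l A p q ^ n"
proof -
  have "prod_list (map f xs) * prod_list (map g xs) = prod_list (map (\<lambda>x. f x * g x) xs)"
    for f g :: "'a \<Rightarrow> real" and xs
    by (induction xs) auto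
  then have "affinity l (lists_len A n) (replicate_pmf n p) (replicate_pmf n q)
      = (\<Sum>xs\<in>lists_len A n. prod_list (map (\<lambda>x. pmf p x powr (1 - l) * pmf q x powr l) xs))"
    unfolding affinity_def by (intro sum.cong) (auto simp: pmf_replicate_pmf prod_list_powr)
  then show ?thesis using assms by (simp add: sum_prod_list_lists_len affinity_def)
qed

lemma prob_finite_support:
  assumes "finite A" "set_pmf P \<subseteq> A"
  shows "measure_pmf.prob P S = (\<Sum>x\<in>A. if x \<in> S then pmf P x else 0)"
proof -
  have "measure_pmf.prob P S = measure_pmf.prob P (S \<inter> A)"
    using assms(2) by (intro measure_pmf.finite_measure_eq_AE) (auto simp: AE_measure_pmf_iff)
  also have "\<dots> = (\<Sum>x\<in>A. if x \<in> S then pmf P x else 0)"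
    using assms(1) by (simp add: measure_measure_pmf_finite sum.inter_restrict Int_commute)
  finally show ?thesis .
qed

lemma bayes_err_finite_support:
  assumes "finite A" "set_pmf P \<subseteq> A" "set_pmf Q \<subseteq> A"
  shows "bayes_err \<pi> P Q \<phi>
    = (\<Sum>x\<in>A. if \<phi> x = Hyp_p then (1 - \<pi>) * pmf Q x else \<pi> * pmf P x)"
proof -
  have "bayes_err \<pi> P Q \<phi> = (\<Sum>x\<in>A. \<pi> * (if \<phi> x \<noteq> Hyp_p then pmf P x else 0)
      + (1 - \<pi>) * (if \<phi> x \<noteq> Hyp_q then pmf Q x else 0))"
    unfolding bayes_err_def err_p_def err_q_def prob_finite_support[OF assms(1,2)]
      prob_finite_support[OF assms(1,3)] sum.distrib sum_distrib_left mem_Collect_eq ..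
  also have "\<dots> = (\<Sum>x\<in>A. if \<phi> x = Hyp_p then (1 - \<pi>) * pmf Q x else \<pi> * pmf P x)"
  proof (intro sum.cong refl)
    fix x show "\<pi> * (if \<phi> x \<noteq> Hyp_p then pmf P x else 0) + (1 - \<pi>) * (if \<phi> x \<noteq> Hyp_q then pmf Q x else 0)
        = (if \<phi> x = Hyp_p then (1 - \<pi>) * pmf Q x else \<pi> * pmf P x)"
      by (cases "\<phi> x") auto
  qed
  finally show ?thesis .
qed

text \<open>The likelihood ratio test pays, at each outcome, the smaller of the two possible
  losses.\<close>

lemma ex_bayes_test:
  fixes P Q :: "'a list pmf"
  assumes "finite A" "set_pmf P \<subseteq> A" "set_pmf Q \<subseteq> A"
  shows "\<exists>\<phi>. bayes_err \<pi> P Q \<phi> = (\<Sum>x\<in>A. min (\<pi> * pmf P x) ((1 - \<pi>) * pmf Q x))"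
proof
  show "bayes_err \<pi> P Q (\<lambda>x. if (1 - \<pi>) * pmf Q x \<le> \<pi> * pmf P x then Hyp_p else Hyp_q)
      = (\<Sum>x\<in>A. min (\<pi> * pmf P x) ((1 - \<pi>) * pmf Q x))"
    unfolding bayes_err_finite_support[OF assms] by (intro sum.cong) (auto simp: min_def)
qed

lemma prob_bind_finite_support:
  assumes "finite A" "set_pmf P \<subseteq> A"
  shows "measure_pmf.prob (bind_pmf P K) S = (\<Sum>x\<in>A. pmf P x * measure_pmf.prob (K x) S)"
proof -
  have "measure_pmf.prob (bind_pmf P K) S = (\<integral>x. measure_pmf.prob (K x) S \<partial>measure_pmf P)"
    unfolding measure_pmf_bind
    by (subst measure_pmf.measure_bind[where N = "count_space UNIV"])
       (auto simp: measure_pmf_in_subprob_algebra)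
  also have "\<dots> = (\<Sum>x\<in>A. measure_pmf.prob (K x) S * pmf P x)"
    using assms by (intro integral_measure_pmf_real) auto
  finally show ?thesis by (simp add: mult.commute)
qed

text \<open>Data processing: a kernel followed by a test is a randomised test, whose loss at x is a
  convex combination of the two losses and hence at least their minimum.\<close>

lemma bayes_err_bind_ge:
  assumes "finite A" "set_pmf P \<subseteq> A" "set_pmf Q \<subseteq> A" "0 \<le> \<pi>" "\<pi> \<le> 1"
  shows "(\<Sum>x\<in>A. min (\<pi> * pmf P x) ((1 - \<pi>) * pmf Q x)) \<le> bayes_err \<pi> (bind_pmf P K) (bind_pmf Q K) \<phi>"
proof -
  have "bayes_err \<pi> (bind_pmf P K) (bind_pmf Q K) \<phi>
     = (\<Sum>x\<in>A. \<pi> * pmf P x * measure_pmf.prob (K x) {x. \<phi> x \<noteq> Hyp_p}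
         + (1 - \<pi>) * pmf Q x * measure_pmf.prob (K x) {x. \<phi> x \<noteq> Hyp_q})"
    unfolding bayes_err_def err_p_def err_q_def prob_bind_finite_support[OF assms(1,2)]
      prob_bind_finite_support[OF assms(1,3)] sum.distrib sum_distrib_left mult.assoc ..
  also have "\<dots> \<ge> (\<Sum>x\<in>A. min (\<pi> * pmf P x) ((1 - \<pi>) * pmf Q x))"
  proof (intro sum_mono)
    fix x assume "x \<in> A"
    let ?a = "measure_pmf.prob (K x) {x. \<phi> x \<noteq> Hyp_p}"
    let ?b = "measure_pmf.prob (K x) {x. \<phi> x \<noteq> Hyp_q}"
    let ?m = "min (\<pi> * pmf P x) ((1 - \<pi>) * pmf Q x)"
    have "\<phi> z \<noteq> Hyp_q \<longleftrightarrow> \<not> \<phi> z \<noteq> Hyp_p" for z by (cases "\<phi> z") auto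
    then have "{x. \<phi> x \<noteq> Hyp_q} = UNIV - {x. \<phi> x \<noteq> Hyp_p}" by auto
    then have "?b = 1 - ?a"
      using measure_pmf.prob_compl[of "{x. \<phi> x \<noteq> Hyp_p}" "K x"] by simp
    then have "?m = ?m * ?a + ?m * ?b" by (simp flip: distrib_left)
    also have "\<dots> \<le> \<pi> * pmf P x * ?a + (1 - \<pi>) * pmf Q x * ?b"
      by (intro add_mono mult_right_mono) auto
    finally show "?m \<le> \<pi> * pmf P x * ?a + (1 - \<pi>) * pmf Q x * ?b" .
  qed
  finally show ?thesis .
qed

text \<open>Independent draws commute, so each channel output can be drawn right after its input.
  This identifies the constrained problem for a fixed channel with the unconstrained one for f(p)
  and f(q).\<close>

lemma bind_replicate_transmit:
  "bind_pmf (replicate_pmf n p) (transmit f) = replicate_pmf n (bind_pmf p f)"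
proof (induction n)
  case (Suc n)
  have "bind_pmf (replicate_pmf (Suc n) p) (transmit f)
      = bind_pmf p (\<lambda>x. bind_pmf (replicate_pmf n p) (\<lambda>xs. bind_pmf (f x) (\<lambda>y. bind_pmf (transmit f xs)
          (\<lambda>ys. return_pmf (y # ys)))))"
    by (simp add: bind_assoc_pmf bind_return_pmf)
  also have "\<dots> = bind_pmf p (\<lambda>x. bind_pmf (f x) (\<lambda>y. bind_pmf (replicate_pmf n p) (\<lambda>xs. bind_pmf (transmit f xs)
          (\<lambda>ys. return_pmf (y # ys)))))"
    by (subst bind_commute_pmf) simp
  also have "\<dots> = replicate_pmf (Suc n) (bind_pmf p f)"
    by (simp add: bind_assoc_pmf flip: Suc.IH)
  finally show ?case .
qed (simp add: bind_return_pmf)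

section \<open>Sample complexities: attainment, data processing and the Chernoff bound\<close>

lemma n_B_le_enat:
  "bayes_err \<pi> (replicate_pmf n p) (replicate_pmf n q) \<phi> \<le> \<delta> \<Longrightarrow> n_B p q \<pi> \<delta> \<le> enat n"
  unfolding n_B_def by (rule Inf_lower) auto

lemma n_B_enatD:
  assumes "n_B p q \<pi> \<delta> = enat n"
  shows "\<exists>\<phi>. bayes_err \<pi> (replicate_pmf n p) (replicate_pmf n q) \<phi> \<le> \<delta>"
proof -
  let ?S = "{enat n | n. \<exists>\<phi>. bayes_err \<pi> (replicate_pmf n p) (replicate_pmf n q) \<phi> \<le> \<delta>}"
  have "?S \<noteq> {}"
  proof
    assume "?S = {}"
    then show False using assms unfolding n_B_def by (simp add: Inf_enat_def)
  qed
  then have "Inf ?S \<in> ?S" unfolding Inf_enat_def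
    using LeastI_ex[of "\<lambda>x. x \<in> ?S"] by (simp only: if_False ex_in_conv not_False_eq_True)
  then show ?thesis using assms by (auto simp: n_B_def)
qed

lemma n_B_le_n_B_comm:
  assumes "finite X" "set_pmf p \<subseteq> X" "set_pmf q \<subseteq> X" "0 \<le> \<pi>" "\<pi> \<le> 1"
  shows "n_B p q \<pi> \<delta> \<le> n_B_comm X p q \<pi> \<delta> D"
  unfolding n_B_comm_def
proof (rule Inf_greatest, safe)
  fix n \<phi> f
  assume *: "bayes_err \<pi> (bind_pmf (replicate_pmf n p) (transmit f)) (bind_pmf (replicate_pmf n q) (transmit f)) \<phi> \<le> \<delta>"
  have fin: "finite (lists_len X n)" using assms(1) by (rule finite_lists_length_eq)
  note sup = set_replicate_pmf_subset[OF assms(2), of n] set_replicate_pmf_subset[OF assms(3), of n]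
  obtain \<psi> where "bayes_err \<pi> (replicate_pmf n p) (replicate_pmf n q) \<psi>
     = (\<Sum>x\<in>lists_len X n. min (\<pi> * pmf (replicate_pmf n p) x) ((1 - \<pi>) * pmf (replicate_pmf n q) x))"
    using ex_bayes_test[OF fin sup] by blast
  also have "\<dots> \<le> \<delta>"
    using bayes_err_bind_ge[OF fin sup assms(4,5)] * by (rule order_trans)
  finally show "n_B p q \<pi> \<delta> \<le> enat n" by (rule n_B_le_enat)
qed

lemma n_B_comm_le:
  assumes "f \<in> channels X D"
  shows "n_B_comm X p q \<pi> \<delta> D \<le> n_B (bind_pmf p f) (bind_pmf q f) \<pi> \<delta>"
  unfolding n_B_def
proof (rule Inf_greatest, safe)
  fix n \<phi>
  assume "bayes_err \<pi> (replicate_pmf n (bind_pmf p f)) (replicate_pmf n (bind_pmf q f)) \<phi> \<le> \<delta>"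
  then show "n_B_comm X p q \<pi> \<delta> D \<le> enat n"
    unfolding n_B_comm_def using assms
    by (intro Inf_lower) (auto simp: bind_replicate_transmit)
qed

text \<open>It rests on min(a, b) <= a^(1-l) b^l for each word. The factor (1 - \<pi>)^l is at most
  1 and is dropped, whereas \<pi>^(1-l) is kept: without it the error could not be brought down to
  \<delta> = \<pi> u at the right rate.\<close>

lemma ex_test_Chernoff:
  assumes "finite A" "set_pmf p \<subseteq> A" "set_pmf q \<subseteq> A" "0 < \<pi>" "\<pi> < 1" "0 \<le> l" "l \<le> 1"
  shows "\<exists>\<phi>. bayes_err \<pi> (replicate_pmf n p) (replicate_pmf n q) \<phi> \<le> \<pi> powr (1 - l) * affinity l A p q ^ n"
proof -
  let ?P = "replicate_pmf n p" and ?Q = "replicate_pmf n q" and ?B = "lists_len A n"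
  have fin: "finite ?B" using assms(1) by (rule finite_lists_length_eq)
  obtain \<psi> where "bayes_err \<pi> ?P ?Q \<psi> = (\<Sum>x\<in>?B. min (\<pi> * pmf ?P x) ((1 - \<pi>) * pmf ?Q x))"
    using ex_bayes_test[OF fin set_replicate_pmf_subset[OF assms(2)] set_replicate_pmf_subset[OF assms(3)]]
    by blast
  also have "\<dots> \<le> (\<Sum>x\<in>?B. \<pi> powr (1 - l) * (pmf ?P x powr (1 - l) * pmf ?Q x powr l))"
  proof (intro sum_mono)
    fix x
    define a b where "a = \<pi> * pmf ?P x" and "b = (1 - \<pi>) * pmf ?Q x"
    have ab: "a \<ge> 0" "b \<ge> 0" using assms by (auto simp: a_def b_def)
    have "min a b = min a b powr (1 - l) * min a b powr l"
      using ab by (cases "min a b = 0") (auto simp: powr_add[symmetric])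
    also have "\<dots> \<le> a powr (1 - l) * b powr l"
      using ab assms by (intro mult_mono powr_mono2) auto
    also have "\<dots> = (1 - \<pi>) powr l * (\<pi> powr (1 - l) * (pmf ?P x powr (1 - l) * pmf ?Q x powr l))"
      using assms by (simp add: a_def b_def powr_mult)
    also have "\<dots> \<le> 1 * (\<pi> powr (1 - l) * (pmf ?P x powr (1 - l) * pmf ?Q x powr l))"
      using assms by (intro mult_right_mono powr_le1) auto
    finally show "min a b \<le> \<pi> powr (1 - l) * (pmf ?P x powr (1 - l) * pmf ?Q x powr l)" by simp
  qed
  also have "\<dots> = \<pi> powr (1 - l) * affinity l A p q ^ n"
    using affinity_replicate[OF assms(1), of l n p q] by (simp add: affinity_def flip: sum_distrib_left)
  finally show ?thesis by blast
qed

text \<open>The total overlap of p and q is at most the affinity and equals the sum of both errors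
  of the likelihood ratio test at prior 1/2. Were the affinity below 1/4, each error would be below
  1/4 with a single sample.\<close>

lemma affinity_ge_of_n_PF:
  assumes "finite A" "set_pmf p \<subseteq> A" "set_pmf q \<subseteq> A" "n_PF p q (1/4) (1/4) \<ge> 2" "0 \<le> l" "l \<le> 1"
  shows "1/4 \<le> affinity l A p q"
proof (rule ccontr)
  assume neg: "\<not> 1/4 \<le> affinity l A p q"
  let ?P = "replicate_pmf 1 p" and ?Q = "replicate_pmf 1 q" and ?B = "lists_len A 1"
  have fin: "finite ?B" using assms(1) by (rule finite_lists_length_eq)
  obtain \<phi> where \<phi>: "bayes_err (1/2) ?P ?Q \<phi> = (\<Sum>x\<in>?B. min (1/2 * pmf ?P x) ((1 - 1/2) * pmf ?Q x))"
    using ex_bayes_test[OF fin set_replicate_pmf_subset[OF assms(2)] set_replicate_pmf_subset[OF assms(3)], of "1/2"]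
    by blast
  have "2 * (\<Sum>x\<in>?B. min (1/2 * pmf ?P x) ((1 - 1/2) * pmf ?Q x)) = (\<Sum>x\<in>?B. min (pmf ?P x) (pmf ?Q x))"
    unfolding sum_distrib_left by (intro sum.cong) (auto simp: min_def)
  also have "\<dots> \<le> (\<Sum>x\<in>?B. pmf ?P x powr (1 - l) * pmf ?Q x powr l)"
  proof (intro sum_mono)
    fix x
    define a b where "a = pmf ?P x" and "b = pmf ?Q x"
    have ab: "a \<ge> 0" "b \<ge> 0" using assms by (auto simp: a_def b_def)
    have "min a b = min a b powr (1 - l) * min a b powr l"
      using ab by (cases "min a b = 0") (auto simp: powr_add[symmetric])
    also have "\<dots> \<le> a powr (1 - l) * b powr l"
      using ab assms by (intro mult_mono powr_mono2) auto
    finally show "min a b \<le> a powr (1 - l) * b powr l" .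
  qed
  also have "\<dots> = affinity l A p q"
    using affinity_replicate[OF assms(1), of l 1 p q] by (simp add: affinity_def)
  finally have "err_p ?P \<phi> + err_q ?Q \<phi> < 1/4"
    using \<phi> neg by (simp add: bayes_err_def)
  moreover have "err_p ?P \<phi> \<ge> 0" "err_q ?Q \<phi> \<ge> 0" by (auto simp: err_p_def err_q_def)
  ultimately have "err_p ?P \<phi> \<le> 1/4 \<and> err_q ?Q \<phi> \<le> 1/4" by linarith
  then have "n_PF p q (1/4) (1/4) \<le> enat 1"
    unfolding n_PF_def by (intro Inf_lower) blast
  then have "(2::enat) \<le> 1" using assms(4) by (auto simp only: one_enat_def intro: order_trans)
  then show False by simp
qed

section \<open>Total correctness with a time bound\<close>

lemma nats_nset [simp]: "nats (nset A i v s) B j = (if A = B \<and> i = j then v else nats s B j)"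
  and nats_rset [simp]: "nats (rset A i x s) = nats s"
  and reals_rset [simp]: "reals (rset A i x s) B j = (if A = B \<and> i = j then x else reals s B j)"
  and reals_nset [simp]: "reals (nset A i v s) = reals s"
  by (auto simp: nset_def rset_def)

lemma nats_nset_other [simp]: "A \<noteq> B \<Longrightarrow> nats (nset A i v s) B = nats s B"
  and reals_rset_other [simp]: "A \<noteq> B \<Longrightarrow> reals (rset A i x s) B = reals s B"
  by (auto simp: nset_def rset_def)

text \<open>A total-correctness triple with a step budget \<open>T\<close>.\<close>

definition total_within :: "(store \<Rightarrow> bool) \<Rightarrow> program \<Rightarrow> nat \<Rightarrow> (store \<Rightarrow> bool) \<Rightarrow> bool" where
  "total_within P c T Q \<longleftrightarrow> (\<forall>s. P s \<longrightarrow> (\<exists>t s'. run c s t s' \<and> t \<le> T \<and> Q s'))"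

lemma total_within_conseq:
  assumes "total_within P' c T' Q'" "\<And>s. P s \<Longrightarrow> P' s" "\<And>s. Q' s \<Longrightarrow> Q s" "T' \<le> T"
  shows "total_within P c T Q"
  using assms unfolding total_within_def by (meson order_trans)

lemma total_within_pre:
  assumes "total_within P' c T' Q" "\<And>s. P s \<Longrightarrow> P' s" "T' \<le> T"
  shows "total_within P c T Q"
  using total_within_conseq[OF assms(1,2) _ assms(3)] by simp

lemma total_within_Skip: "total_within Q Skip 1 Q"
  unfolding total_within_def using run.Skip by blast

lemma total_within_NSet: "total_within (\<lambda>s. Q (nset A (nval i s) (nval e s) s)) (NSet A i e) 1 Q"
  unfolding total_within_def using run.NSet by blast

lemma total_within_RSet: "total_within (\<lambda>s. Q (rset A (nval i s) (rval e s) s)) (RSet A i e) 1 Q"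
  unfolding total_within_def using run.RSet by blast

text \<open>The premise for \<open>c2\<close> comes first, so that repeated resolution moves
  backwards from the known postcondition and finds the weakest preconditions by unification.\<close>

lemma total_within_Seq:
  assumes "total_within R c2 T2 Q" "total_within P c1 T1 R"
  shows "total_within P (Seq c1 c2) (T1 + T2) Q"
  unfolding total_within_def
proof (intro allI impI)
  fix s assume "P s"
  then obtain t1 s1 where 1: "run c1 s t1 s1" "t1 \<le> T1" "R s1"
    using assms(2) by (auto simp: total_within_def)
  then obtain t2 s2 where 2: "run c2 s1 t2 s2" "t2 \<le> T2" "Q s2"
    using assms(1) by (auto simp: total_within_def)
  show "\<exists>t s'. run (Seq c1 c2) s t s' \<and> t \<le> T1 + T2 \<and> Q s'"
    using run.Seq[OF 1(1) 2(1)] 1(2) 2(2,3) by (meson add_mono)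
qed

lemma total_within_Seq':
  assumes "total_within U c2 T2 Q" "total_within P c1 T1 U'" "\<And>s. U' s \<Longrightarrow> U s"
  shows "total_within P (Seq c1 c2) (T1 + T2) Q"
  using total_within_Seq[OF assms(1) total_within_conseq[OF assms(2) _ assms(3)]] by simp

lemma total_within_If:
  assumes "total_within P1 c1 T1 Q" "total_within P2 c2 T2 Q"
  shows "total_within (\<lambda>s. (bval b s \<longrightarrow> P1 s) \<and> (\<not> bval b s \<longrightarrow> P2 s)) (If b c1 c2) (1 + (T1 + T2)) Q"
  unfolding total_within_def
proof (intro allI impI)
  fix s assume *: "(bval b s \<longrightarrow> P1 s) \<and> (\<not> bval b s \<longrightarrow> P2 s)"
  show "\<exists>t s'. run (If b c1 c2) s t s' \<and> t \<le> 1 + (T1 + T2) \<and> Q s'"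
  proof (cases "bval b s")
    case True
    then obtain t s' where "run c1 s t s'" "t \<le> T1" "Q s'"
      using assms(1) * by (auto simp: total_within_def)
    then show ?thesis
      using run.IfTrue[OF True] by (intro exI[of _ "1 + t"] exI[of _ s']) auto
  next
    case False
    then obtain t s' where "run c2 s t s'" "t \<le> T2" "Q s'"
      using assms(2) * by (auto simp: total_within_def)
    then show ?thesis
      using run.IfFalse[OF False] by (intro exI[of _ "1 + t"] exI[of _ s']) auto
  qed
qed

lemma total_within_While:
  assumes body: "\<And>n. total_within (\<lambda>s. I s \<and> bval b s \<and> V s = n) c T (\<lambda>s. I s \<and> V s < n)"
  shows "total_within (\<lambda>s. I s \<and> V s \<le> K) (While b c) (1 + K * (T + 1)) (\<lambda>s. I s \<and> \<not> bval b s)"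
proof -
  have "I s \<Longrightarrow> \<exists>t s'. run (While b c) s t s' \<and> t \<le> 1 + V s * (T + 1) \<and> I s' \<and> \<not> bval b s'" for s
  proof (induction "V s" arbitrary: s rule: less_induct)
    case less
    show ?case
    proof (cases "bval b s")
      case True
      then obtain t1 s1 where 1: "run c s t1 s1" "t1 \<le> T" "I s1" "V s1 < V s"
        using body[of "V s"] less.prems by (auto simp: total_within_def)
      obtain t2 s2 where 2: "run (While b c) s1 t2 s2" "t2 \<le> 1 + V s1 * (T + 1)" "I s2" "\<not> bval b s2"
        using less.hyps[OF 1(4,3)] by blast
      have "1 + t1 + t2 \<le> 1 + Suc (V s1) * (T + 1)" using 1(2) 2(2) by simp
      also have "\<dots> \<le> 1 + V s * (T + 1)"
        using 1(4) by (intro add_left_mono mult_right_mono) auto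
      finally show ?thesis using run.WhileTrue[OF True 1(1) 2(1)] 2(3,4) by blast
    next
      case False
      then show ?thesis using run.WhileFalse[OF False] less.prems
        by (intro exI[of _ 1] exI[of _ s]) auto
    qed
  qed
  moreover have "1 + V s * (T + 1) \<le> 1 + K * (T + 1)" if "V s \<le> K" for s
    using that by (intro add_left_mono mult_right_mono) auto
  ultimately show ?thesis unfolding total_within_def by (meson order_trans)
qed

text \<open>For loops counted by a natural: the invariant is indexed by the number of completed
  rounds, which replaces the variant. Loops steered by comparisons of reals use the variant rule
  instead.\<close>

lemma total_within_for:
  assumes body: "\<And>n. n < K \<Longrightarrow> total_within (J n) c T (J (Suc n))"
    and test: "\<And>n s. n \<le> K \<Longrightarrow> J n s \<Longrightarrow> bval b s \<longleftrightarrow> n < K"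
  shows "total_within (J 0) (While b c) (1 + K * (T + 1)) (J K)"
proof -
  have "n \<le> K \<Longrightarrow> J n s \<Longrightarrow> \<exists>t s'. run (While b c) s t s' \<and> t \<le> 1 + (K - n) * (T + 1) \<and> J K s'" for n s
  proof (induction "K - n" arbitrary: n s)
    case 0
    then have "n = K" "\<not> bval b s" using test[of n s] by auto
    then show ?case using run.WhileFalse[of b s c] 0 by (intro exI[of _ 1] exI[of _ s]) auto
  next
    case (Suc d)
    then have n: "n < K" "bval b s" using test[of n s] by auto
    obtain t1 s1 where 1: "run c s t1 s1" "t1 \<le> T" "J (Suc n) s1"
      using body[OF n(1)] Suc.prems by (auto simp: total_within_def)
    have d: "d = K - Suc n" "Suc n \<le> K" using Suc.hyps(2) n by auto
    obtain t2 s2 where 2: "run (While b c) s1 t2 s2" "t2 \<le> 1 + (K - Suc n) * (T + 1)" "J K s2"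
      using Suc.hyps(1)[OF d 1(3)] by blast
    have "1 + t1 + t2 \<le> 1 + Suc (K - Suc n) * (T + 1)" using 1(2) 2(2) by simp
    also have "Suc (K - Suc n) = K - n" using n by simp
    finally show ?case using run.WhileTrue[OF n(2) 1(1) 2(1)] 2(3) by blast
  qed
  from this[of 0] show ?thesis unfolding total_within_def by auto
qed

text \<open>It turns a quantity found at run time, such as the current labelling or the chosen
  bucket, into a fixed parameter, so that specifications with parameters apply.\<close>

lemma total_within_ex:
  "(\<And>x. total_within (P x) c T Q) \<Longrightarrow> total_within (\<lambda>s. \<exists>x. P x s) c T Q"
  by (auto simp: total_within_def)

lemmas total_within_wp = total_within_Skip total_within_NSet total_within_RSet total_within_Seq total_within_If

text \<open>
  The products say that \<open>v j\<close> lies between \<open>v i\<close> (included) and \<open>2 * v i\<close> (excluded), whatever the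
  sign; the bucket of an \<open>i\<close> with \<open>v i = 0\<close> is empty.
\<close>

definition bucket :: "(nat \<Rightarrow> real) \<Rightarrow> nat \<Rightarrow> nat \<Rightarrow> bool" where
  "bucket v i j \<longleftrightarrow> v i * v i \<le> v i * v j \<and> v i * v j < 2 * (v i * v i)"

text \<open>The score that bucket \<open>i\<close> would add to what is already covered. Being
  unlabelled is written as a negated comparison, as the program tests it.\<close>

definition gain :: "nat \<Rightarrow> nat \<Rightarrow> (nat \<Rightarrow> real) \<Rightarrow> (nat \<Rightarrow> real) \<Rightarrow> (nat \<Rightarrow> nat) \<Rightarrow> nat \<Rightarrow> real" where
  "gain k D v sc c i = (\<Sum>j<k. if \<not> c j < D - 1 \<and> bucket v i j then sc j else 0)"

text \<open>
  Labels run from \<open>0\<close>, and \<open>D - 1\<close> marks the points that are not (yet) in a chosen bucket.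
\<close>

inductive greedy :: "nat \<Rightarrow> nat \<Rightarrow> (nat \<Rightarrow> real) \<Rightarrow> (nat \<Rightarrow> real) \<Rightarrow> nat \<Rightarrow> (nat \<Rightarrow> nat) \<Rightarrow> bool"
  for k D v sc where
  init: "(\<And>j. j < k \<Longrightarrow> c j = D - 1) \<Longrightarrow> greedy k D v sc 0 c"
| step: "greedy k D v sc y c \<Longrightarrow> y < D - 1 \<Longrightarrow> b < k \<Longrightarrow>
    (\<And>i. i < k \<Longrightarrow> gain k D v sc c i \<le> gain k D v sc c b) \<Longrightarrow>
    (\<And>j. j < k \<Longrightarrow> c' j = (if \<not> c j < D - 1 \<and> bucket v b j then y else c j)) \<Longrightarrow>
    greedy k D v sc (Suc y) c'"

text \<open>\<open>v\<close> is the signed quantity by which points are bucketed: the score is v^2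
  per unit of p + q near ratio 1, and the absolute value of v per unit of p on the levels. A point
  with q = 0, even with p = 0, has no finite level and falls under \<open>l = M\<close>.\<close>

definition scored :: "nat \<Rightarrow> real \<Rightarrow> real \<Rightarrow> real \<Rightarrow> real \<Rightarrow> bool" where
  "scored M p q v sc \<longleftrightarrow>
    p < 2 * q \<and> v = (q - p) / (p + q) \<and> sc = v * v * (p + q) \<or>
    (\<exists>l. 1 \<le> l \<and> l \<le> M \<and> 2 * q \<le> p \<and> 2 ^ l * q \<le> p \<and> (p < 2 ^ (l + 1) * q \<or> l = M) \<and>
       v = - real l \<and> sc = p * real l)"

lemma scored_nonneg:
  assumes "scored M p q v sc" "0 \<le> p" "0 \<le> q"
  shows "0 \<le> sc"
  using assms by (auto simp: scored_def)

abbreviation "nvar x \<equiv> NGet x (NConst 0)"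
abbreviation "rvar x \<equiv> RGet x (NConst 0)"
abbreviation "inc x \<equiv> NSet x (NConst 0) (NAdd (nvar x) (NConst 1))"
abbreviation "zero x \<equiv> NSet x (NConst 0) (NConst 0)"
abbreviation "rlet x e \<equiv> RSet x (NConst 0) e"

text \<open>\<open>u\<close> and \<open>w\<close> hold \<open>\<delta> / \<pi>\<close> and its powers; the least suitable exponent is left in \<open>m\<close>.\<close>

definition level_prog :: program where
  "level_prog =
     Seq (rlet ''u'' (RDiv (rvar ''delta'') (rvar ''pi'')))
    (Seq (rlet ''w'' (rvar ''u''))
    (Seq (rlet ''m'' (RConst 1))
         (While (RLess (rvar ''pi'') (rvar ''w''))
            (Seq (rlet ''w'' (RMul (rvar ''w'') (rvar ''u'')))
                 (rlet ''m'' (RAdd (rvar ''m'') (RConst 1)))))))"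

text \<open>\<open>z\<close> holds 2^(l+1) q and is doubled along with each increment, so the level
  is found by comparisons alone; for q = 0 only the cap \<open>m\<close> stops the loop. Both
  \<open>l\<close> and \<open>m\<close> are kept as reals because the level enters the score as a
  real factor and no expression converts naturals to reals.\<close>

definition score_one :: program where
  "score_one =
    If (RLess (RGet ''p'' (nvar ''i'')) (RMul (RConst 2) (RGet ''q'' (nvar ''i''))))
      (Seq (RSet ''v'' (nvar ''i'') (RDiv (RSub (RGet ''q'' (nvar ''i'')) (RGet ''p'' (nvar ''i'')))
                                       (RAdd (RGet ''p'' (nvar ''i'')) (RGet ''q'' (nvar ''i'')))))
           (RSet ''s'' (nvar ''i'') (RMul (RMul (RGet ''v'' (nvar ''i'')) (RGet ''v'' (nvar ''i'')))
                                       (RAdd (RGet ''p'' (nvar ''i'')) (RGet ''q'' (nvar ''i''))))))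
      (Seq (rlet ''l'' (RConst 1))
      (Seq (rlet ''z'' (RMul (RConst 4) (RGet ''q'' (nvar ''i''))))
      (Seq (While (And (Not (RLess (RGet ''p'' (nvar ''i'')) (rvar ''z''))) (RLess (rvar ''l'') (rvar ''m'')))
             (Seq (rlet ''l'' (RAdd (rvar ''l'') (RConst 1)))
                  (rlet ''z'' (RAdd (rvar ''z'') (rvar ''z'')))))
      (Seq (RSet ''v'' (nvar ''i'') (RSub (RConst 0) (rvar ''l'')))
           (RSet ''s'' (nvar ''i'') (RMul (RGet ''p'' (nvar ''i'')) (rvar ''l'')))))))"

definition score_prog :: program where
  "score_prog =
     Seq (zero ''i'')
         (While (NLess (nvar ''i'') (nvar ''k''))
            (Seq score_one
            (Seq (NSet ''c'' (nvar ''i'') (NSub (nvar ''D'') (NConst 1)))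
                 (inc ''i''))))"

definition in_bucket :: "string \<Rightarrow> bexp" where
  "in_bucket a =
    And (Not (NLess (NGet ''c'' (nvar ''j'')) (NSub (nvar ''D'') (NConst 1))))
   (And (Not (RLess (RMul (RGet ''v'' (nvar a)) (RGet ''v'' (nvar ''j''))) (RMul (RGet ''v'' (nvar a)) (RGet ''v'' (nvar a)))))
        (RLess (RMul (RGet ''v'' (nvar a)) (RGet ''v'' (nvar ''j'')))
               (RMul (RConst 2) (RMul (RGet ''v'' (nvar a)) (RGet ''v'' (nvar a))))))"

definition gain_prog :: program where
  "gain_prog =
     Seq (rlet ''sum'' (RConst 0))
    (Seq (zero ''j'')
         (While (NLess (nvar ''j'') (nvar ''k''))
           (Seq (If (in_bucket ''i'') (rlet ''sum'' (RAdd (rvar ''sum'') (RGet ''s'' (nvar ''j'')))) Skip)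
                (inc ''j''))))"

definition best_prog :: program where
  "best_prog =
     Seq (rlet ''best'' (RConst 0))
    (Seq (zero ''b'')
    (Seq (zero ''i'')
         (While (NLess (nvar ''i'') (nvar ''k''))
           (Seq gain_prog
           (Seq (If (RLess (rvar ''best'') (rvar ''sum''))
                    (Seq (rlet ''best'' (rvar ''sum'')) (NSet ''b'' (NConst 0) (nvar ''i''))) Skip)
                (inc ''i''))))))"

definition mark_prog :: program where
  "mark_prog =
     Seq (zero ''j'')
         (While (NLess (nvar ''j'') (nvar ''k''))
           (Seq (If (in_bucket ''b'') (NSet ''c'' (nvar ''j'') (nvar ''y'')) Skip)
                (inc ''j'')))"

definition greedy_prog :: program where
  "greedy_prog =
     Seq (zero ''y'')
         (While (NLess (nvar ''y'') (NSub (nvar ''D'') (NConst 1)))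
           (Seq best_prog (Seq mark_prog (inc ''y''))))"

text \<open>\<open>x\<close> accumulates \<open>i * D\<close>, since naturals cannot be multiplied.\<close>

definition output_prog :: program where
  "output_prog =
     Seq (zero ''x'')
    (Seq (zero ''i'')
         (While (NLess (nvar ''i'') (nvar ''k''))
           (Seq (RSet ''f'' (NAdd (nvar ''x'') (NGet ''c'' (nvar ''i''))) (RConst 1))
           (Seq (NSet ''x'' (NConst 0) (NAdd (nvar ''x'') (nvar ''D'')))
                (inc ''i'')))))"

definition quantizer_prog :: program where
  "quantizer_prog = Seq level_prog (Seq score_prog (Seq greedy_prog output_prog))"

text \<open>The array \<open>f\<close> is required to be zero because the output stage writes only
  the ones of the matrix.\<close>

definition holds_input :: "nat \<Rightarrow> nat \<Rightarrow> (nat \<Rightarrow> real) \<Rightarrow> (nat \<Rightarrow> real) \<Rightarrow> store \<Rightarrow> bool" where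
  "holds_input k D p q s \<longleftrightarrow> nats s ''k'' 0 = k \<and> nats s ''D'' 0 = D \<and> (\<forall>i. reals s ''f'' i = 0) \<and>
     (\<forall>i<k. reals s ''p'' i = p i) \<and> (\<forall>i<k. reals s ''q'' i = q i)"

definition holds_scores :: "nat \<Rightarrow> nat \<Rightarrow> (nat \<Rightarrow> real) \<Rightarrow> (nat \<Rightarrow> real) \<Rightarrow> store \<Rightarrow> bool" where
  "holds_scores k D v sc s \<longleftrightarrow> nats s ''k'' 0 = k \<and> nats s ''D'' 0 = D \<and> (\<forall>i. reals s ''f'' i = 0) \<and>
     (\<forall>i<k. reals s ''v'' i = v i) \<and> (\<forall>i<k. reals s ''s'' i = sc i)"

section \<open>Correctness and running time of the stages\<close>

lemma level_prog_spec:
  assumes "0 < \<pi>" "0 < \<delta>" "\<delta> < \<pi> / 4" "\<pi> < 1"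
  shows "total_within
    (\<lambda>s. holds_input k D p q s \<and> reals s ''pi'' 0 = \<pi> \<and> reals s ''delta'' 0 = \<delta>)
    level_prog (4 + 3 * nat \<lfloor>ln (1 / \<delta>)\<rfloor>)
    (\<lambda>s. \<exists>M. 1 \<le> M \<and> M \<le> nat \<lfloor>ln (1 / \<delta>)\<rfloor> \<and> (\<delta> / \<pi>) ^ M \<le> \<pi> \<and> \<delta> < (\<delta> / \<pi>) ^ M \<and>
       holds_input k D p q s \<and> reals s ''m'' 0 = real M)"
proof -
  define u where "u = \<delta> / \<pi>"
  define K where "K = nat \<lfloor>ln (1 / \<delta>)\<rfloor>"
  have u: "0 < u" "u < 1/4" "\<pi> * u = \<delta>" using assms by (auto simp: u_def field_simps)
  \<comment> \<open>u < 1/4 < 1/e, so \<delta> < u^M forces M < ln(1/\<delta>); this bounds the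
    number of iterations.\<close>
  have le_K: "M \<le> K" if "\<delta> < u ^ M" for M
  proof -
    have "u ^ M \<le> exp (- 1) ^ M"
    proof (rule power_mono)
      have "exp (- 1 :: real) \<ge> 1/4"
        using exp_le by (simp add: exp_minus field_simps)
      then show "u \<le> exp (- 1)" using u by simp
    qed (use u in simp)
    also have "\<dots> = exp (- real M)" by (simp flip: exp_of_nat_mult)
    finally have "ln \<delta> < - real M" using that assms ln_less_cancel_iff[of \<delta> "exp (- real M)"] by simp
    then have "real M \<le> ln (1 / \<delta>)" using assms by (simp add: ln_div)
    then show ?thesis unfolding K_def by linarith
  qed
  \<comment> \<open>The invariant \<delta> < u^M takes the place of minimality of M: another factor
    u is multiplied in only while \<pi> < u^M, and \<pi> u = \<delta>.\<close>
  define I where "I s \<longleftrightarrow> (\<exists>M. 1 \<le> M \<and> \<delta> < u ^ M \<and> holds_input k D p q s \<and> reals s ''pi'' 0 = \<pi> \<and>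
      reals s ''u'' 0 = u \<and> reals s ''w'' 0 = u ^ M \<and> reals s ''m'' 0 = real M)" for s
  \<comment> \<open>The counter is stored as a real, hence the rounding; on stores satisfying
    \<open>I\<close> it is exact.\<close>
  let ?V = "\<lambda>s. K - nat \<lfloor>reals s ''m'' 0\<rfloor>"
  have loop: "total_within (\<lambda>s. I s \<and> ?V s \<le> K)
       (While (RLess (rvar ''pi'') (rvar ''w''))
            (Seq (rlet ''w'' (RMul (rvar ''w'') (rvar ''u'')))
                 (rlet ''m'' (RAdd (rvar ''m'') (RConst 1))))) (1 + K * (2 + 1))
        (\<lambda>s. I s \<and> \<not> bval (RLess (rvar ''pi'') (rvar ''w'')) s)"
  proof (rule total_within_While, rule total_within_pre, (rule total_within_wp)+, goal_cases)
    case (1 n s)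
    then obtain M where M: "1 \<le> M" "\<delta> < u ^ M" "holds_input k D p q s" "reals s ''pi'' 0 = \<pi>"
      "reals s ''u'' 0 = u" "reals s ''w'' 0 = u ^ M" "reals s ''m'' 0 = real M"
      unfolding I_def by blast
    have "\<pi> < u ^ M" using 1 M by simp
    then have d: "\<delta> < u ^ Suc M" using u(1,3) mult_strict_right_mono[of \<pi> "u ^ M" u]
      by (simp add: mult.commute)
    then have K: "Suc M \<le> K" by (rule le_K)
    have "nat \<lfloor>1 + real M\<rfloor> = Suc M" by (simp add: nat_add_distrib)
    moreover have "n = K - M" using 1 M by simp
    ultimately show ?case
    proof (intro conjI, goal_cases)
      case 1
      show ?case unfolding I_def
        by (rule exI[of _ "Suc M"]) (use M d in \<open>simp add: holds_input_def mult.commute\<close>)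
    next
      case 2
      then show ?case using M(7) K by simp
    qed
  next
    case 2 show ?case by (rule eq_refl) simp
  qed
  have "total_within
    (\<lambda>s. holds_input k D p q s \<and> reals s ''pi'' 0 = \<pi> \<and> reals s ''delta'' 0 = \<delta>)
    level_prog (4 + 3 * K) (\<lambda>s. I s \<and> \<not> bval (RLess (rvar ''pi'') (rvar ''w'')) s)"
    unfolding level_prog_def
  proof (rule total_within_pre, (rule total_within_Seq)+, rule loop, (rule total_within_wp)+, goal_cases)
    case (1 s)
    have "\<delta> < u" using u(1,3) mult_strict_right_mono[of \<pi> 1 u] assms(4) by simp
    then show ?case unfolding I_def
      by (intro conjI exI[of _ 1]) (use 1 in \<open>simp_all add: holds_input_def u_def\<close>)
  next
    case 2 show ?case by simp
  qed
  then show ?thesis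
  proof (rule total_within_conseq, goal_cases)
    case (2 s)
    then obtain M where M: "1 \<le> M" "\<delta> < u ^ M" "holds_input k D p q s" "reals s ''pi'' 0 = \<pi>"
      "reals s ''u'' 0 = u" "reals s ''w'' 0 = u ^ M" "reals s ''m'' 0 = real M"
      unfolding I_def by blast
    then show ?case using 2 le_K[of M] unfolding u_def K_def by (intro exI[of _ M]) auto
  qed (auto simp: K_def)
qed

lemma score_one_spec:
  assumes "1 \<le> M" "M \<le> K" "0 \<le> p i" "0 \<le> q i" "i < k"
  shows "total_within (\<lambda>s. holds_input k D p q s \<and> reals s ''m'' 0 = real M \<and> nats s ''i'' 0 = i \<and>
       (\<forall>j<i. nats s ''c'' j = D - 1 \<and> scored M (p j) (q j) (reals s ''v'' j) (reals s ''s'' j)))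
     score_one (10 + 3 * K)
     (\<lambda>s. holds_input k D p q s \<and> reals s ''m'' 0 = real M \<and> nats s ''i'' 0 = i \<and>
       (\<forall>j<i. nats s ''c'' j = D - 1) \<and>
       (\<forall>j<Suc i. scored M (p j) (q j) (reals s ''v'' j) (reals s ''s'' j)))"
proof -
  define E where "E s \<longleftrightarrow> holds_input k D p q s \<and> reals s ''m'' 0 = real M \<and> nats s ''i'' 0 = i \<and>
       (\<forall>j<i. nats s ''c'' j = D - 1 \<and> scored M (p j) (q j) (reals s ''v'' j) (reals s ''s'' j))" for s
  define I where "I s \<longleftrightarrow> (\<exists>l. 1 \<le> l \<and> l \<le> M \<and> E s \<and> 2 * q i \<le> p i \<and> 2 ^ l * q i \<le> p i \<and>
    reals s ''l'' 0 = real l \<and> reals s ''z'' 0 = 2 ^ (l + 1) * q i)" for s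
  let ?V = "\<lambda>s. M - nat \<lfloor>reals s ''l'' 0\<rfloor>"
  let ?b = "And (Not (RLess (RGet ''p'' (nvar ''i'')) (rvar ''z''))) (RLess (rvar ''l'') (rvar ''m''))"
  have loop: "total_within (\<lambda>s. I s \<and> ?V s \<le> M)
       (While ?b (Seq (rlet ''l'' (RAdd (rvar ''l'') (RConst 1)))
                  (rlet ''z'' (RAdd (rvar ''z'') (rvar ''z''))))) (1 + M * (2 + 1))
        (\<lambda>s. I s \<and> \<not> bval ?b s)"
  proof (rule total_within_While, rule total_within_pre, (rule total_within_wp)+, goal_cases)
    case (1 n s)
    then obtain l where l: "1 \<le> l" "l \<le> M" "E s" "2 * q i \<le> p i" "2 ^ l * q i \<le> p i"
      "reals s ''l'' 0 = real l" "reals s ''z'' 0 = 2 ^ (l + 1) * q i"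
      unfolding I_def by blast
    have "nat \<lfloor>1 + real l\<rfloor> = Suc l" by (simp add: nat_add_distrib)
    moreover have "n = M - l" using 1 l by simp
    moreover have "l < M" "2 ^ Suc l * q i \<le> p i"
      using 1 l assms(5) by (auto simp: E_def holds_input_def)
    ultimately show ?case
    proof (intro conjI, goal_cases)
      case 1
      then show ?case unfolding I_def
        by (intro exI[of _ "Suc l"]) (use l in \<open>simp add: holds_input_def E_def\<close>)
    next
      case 2
      then show ?case using l(2,6) by simp
    qed
  next
    case 2 show ?case by simp
  qed
  let ?Q = "\<lambda>s. holds_input k D p q s \<and> reals s ''m'' 0 = real M \<and> nats s ''i'' 0 = i \<and>
       (\<forall>j<i. nats s ''c'' j = D - 1) \<and>
       (\<forall>j<Suc i. scored M (p j) (q j) (reals s ''v'' j) (reals s ''s'' j))"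
  have fin: "total_within (\<lambda>s. I s \<and> \<not> bval ?b s)
      (Seq (RSet ''v'' (nvar ''i'') (RSub (RConst 0) (rvar ''l'')))
           (RSet ''s'' (nvar ''i'') (RMul (RGet ''p'' (nvar ''i'')) (rvar ''l'')))) 2 ?Q"
  proof (rule total_within_pre, (rule total_within_wp)+, goal_cases)
    case (1 s)
    then obtain l where l: "1 \<le> l" "l \<le> M" "E s" "2 * q i \<le> p i" "2 ^ l * q i \<le> p i"
      "reals s ''l'' 0 = real l" "reals s ''z'' 0 = 2 ^ (l + 1) * q i"
      unfolding I_def by blast
    have "p i < 2 ^ (l + 1) * q i \<or> l = M"
      using 1 l assms(5) by (auto simp: E_def holds_input_def)
    then have "scored M (p i) (q i) (- real l) (p i * real l)"
      using l unfolding scored_def by blast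
    moreover have "reals s ''p'' i = p i" using l(3) assms(5) by (simp add: E_def holds_input_def)
    ultimately show ?case using l(3,6)
      by (auto simp: E_def holds_input_def less_Suc_eq)
  next
    case 2 show ?case by simp
  qed
  let ?c = "RLess (RGet ''p'' (nvar ''i'')) (RMul (RConst 2) (RGet ''q'' (nvar ''i'')))"
  have "total_within (\<lambda>s. E s \<and> bval ?c s)
      (Seq (RSet ''v'' (nvar ''i'') (RDiv (RSub (RGet ''q'' (nvar ''i'')) (RGet ''p'' (nvar ''i'')))
                                       (RAdd (RGet ''p'' (nvar ''i'')) (RGet ''q'' (nvar ''i'')))))
           (RSet ''s'' (nvar ''i'') (RMul (RMul (RGet ''v'' (nvar ''i'')) (RGet ''v'' (nvar ''i'')))
                                       (RAdd (RGet ''p'' (nvar ''i'')) (RGet ''q'' (nvar ''i'')))))) 2 ?Q"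
  proof (rule total_within_pre, (rule total_within_wp)+, goal_cases)
    case (1 s)
    then have E: "E s" by simp
    have pq: "reals s ''p'' i = p i" "reals s ''q'' i = q i" "nats s ''i'' 0 = i"
      using E assms(5) by (simp_all add: E_def holds_input_def)
    have "p i < 2 * q i" using 1 pq by simp
    then have "scored M (p i) (q i) ((q i - p i) / (p i + q i))
       ((q i - p i) / (p i + q i) * ((q i - p i) / (p i + q i)) * (p i + q i))"
      unfolding scored_def by blast
    then show ?case using E pq
      by (auto simp: E_def holds_input_def less_Suc_eq simp del: times_divide_eq_left times_divide_eq_right)
  next
    case 2 show ?case by simp
  qed
  moreover have "total_within (\<lambda>s. E s \<and> \<not> bval ?c s)
      (Seq (rlet ''l'' (RConst 1))
      (Seq (rlet ''z'' (RMul (RConst 4) (RGet ''q'' (nvar ''i''))))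
      (Seq (While ?b (Seq (rlet ''l'' (RAdd (rvar ''l'') (RConst 1)))
                  (rlet ''z'' (RAdd (rvar ''z'') (rvar ''z'')))))
      (Seq (RSet ''v'' (nvar ''i'') (RSub (RConst 0) (rvar ''l'')))
           (RSet ''s'' (nvar ''i'') (RMul (RGet ''p'' (nvar ''i'')) (rvar ''l'')))))))
      (5 + 3 * K) ?Q"
  proof (rule total_within_pre, rule total_within_Seq, rule total_within_Seq, rule total_within_Seq, rule fin, rule loop, (rule total_within_wp)+, goal_cases)
    case (1 s)
    then have E: "E s" by simp
    have pq: "reals s ''p'' i = p i" "reals s ''q'' i = q i" "nats s ''i'' 0 = i"
      using E assms(5) by (simp_all add: E_def holds_input_def)
    have "2 * q i \<le> p i" using 1 pq by simp
    then show ?case unfolding I_def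
      by (intro conjI exI[of _ 1]) (use E pq assms(1) in \<open>simp_all add: E_def holds_input_def\<close>)
  next
    case 2 show ?case using assms(2) by simp
  qed
  ultimately show ?thesis
    unfolding score_one_def E_def[symmetric]
    by (rule total_within_pre[OF total_within_If]) auto
qed

lemma score_prog_spec:
  assumes "1 \<le> M" "M \<le> K" "\<And>i. 0 \<le> p i" "\<And>i. 0 \<le> q i"
  shows "total_within (\<lambda>s. holds_input k D p q s \<and> reals s ''m'' 0 = real M)
     score_prog (2 + k * (13 + 3 * K))
     (\<lambda>s. \<exists>v sc. (\<forall>i<k. scored M (p i) (q i) (v i) (sc i)) \<and> holds_scores k D v sc s \<and> (\<forall>i<k. nats s ''c'' i = D - 1))"
proof -
  define J where "J i s \<longleftrightarrow> holds_input k D p q s \<and> reals s ''m'' 0 = real M \<and> nats s ''i'' 0 = i \<and>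
       (\<forall>j<i. nats s ''c'' j = D - 1 \<and> scored M (p j) (q j) (reals s ''v'' j) (reals s ''s'' j))" for i s
  have loop: "total_within (J 0) (While (NLess (nvar ''i'') (nvar ''k''))
            (Seq score_one
            (Seq (NSet ''c'' (nvar ''i'') (NSub (nvar ''D'') (NConst 1)))
                 (inc ''i'')))) (1 + k * (12 + 3 * K + 1)) (J k)"
  proof (rule total_within_for, goal_cases)
    case (1 i)
    have tail: "total_within (\<lambda>s. holds_input k D p q s \<and> reals s ''m'' 0 = real M \<and> nats s ''i'' 0 = i \<and>
       (\<forall>j<i. nats s ''c'' j = D - 1) \<and>
       (\<forall>j<Suc i. scored M (p j) (q j) (reals s ''v'' j) (reals s ''s'' j)))
       (Seq (NSet ''c'' (nvar ''i'') (NSub (nvar ''D'') (NConst 1))) (inc ''i'')) 2 (J (Suc i))"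
      by (rule total_within_pre, (rule total_within_wp)+) (auto simp: J_def holds_input_def less_Suc_eq)
    show ?case
      by (rule total_within_pre[OF total_within_Seq[OF tail score_one_spec[OF assms(1,2,3,4) 1]]])
        (auto simp: J_def)
  next
    case (2 i s)
    then show ?case by (simp add: J_def holds_input_def)
  qed
  have "total_within (\<lambda>s. holds_input k D p q s \<and> reals s ''m'' 0 = real M)
     score_prog (2 + k * (13 + 3 * K)) (J k)"
    unfolding score_prog_def
    by (rule total_within_pre, rule total_within_Seq, rule loop, (rule total_within_wp)+)
      (auto simp: J_def holds_input_def)
  then show ?thesis
  proof (rule total_within_conseq, goal_cases)
    case (2 s)
    then show ?case unfolding J_def holds_input_def holds_scores_def
      by (intro exI[of _ "reals s ''v''"] exI[of _ "reals s ''s''"]) auto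
  qed auto
qed

text \<open>The cells \<open>y\<close>, \<open>b\<close> and \<open>best\<close> appear on both
  sides as a frame condition for the enclosing loops.\<close>

lemma gain_prog_spec:
  assumes "i < k"
  shows "total_within (\<lambda>s. holds_scores k D v sc s \<and> nats s ''c'' = c \<and> nats s ''i'' 0 = i \<and>
        nats s ''y'' 0 = y \<and> nats s ''b'' 0 = b \<and> reals s ''best'' 0 = best)
     gain_prog (3 + k * 5)
     (\<lambda>s. holds_scores k D v sc s \<and> nats s ''c'' = c \<and> nats s ''i'' 0 = i \<and>
        nats s ''y'' 0 = y \<and> nats s ''b'' 0 = b \<and> reals s ''best'' 0 = best \<and> reals s ''sum'' 0 = gain k D v sc c i)"
proof -
  define J where "J n s \<longleftrightarrow> holds_scores k D v sc s \<and> nats s ''c'' = c \<and> nats s ''i'' 0 = i \<and>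
        nats s ''y'' 0 = y \<and> nats s ''b'' 0 = b \<and> reals s ''best'' 0 = best \<and> nats s ''j'' 0 = n \<and>
     reals s ''sum'' 0 = (\<Sum>j<n. if \<not> c j < D - 1 \<and> bucket v i j then sc j else 0)" for n s
  have loop: "total_within (J 0) (While (NLess (nvar ''j'') (nvar ''k''))
           (Seq (If (in_bucket ''i'') (rlet ''sum'' (RAdd (rvar ''sum'') (RGet ''s'' (nvar ''j'')))) Skip)
                (inc ''j''))) (1 + k * (4 + 1)) (J k)"
  proof (rule total_within_for, goal_cases)
    case (1 n)
    show ?case
    proof (rule total_within_pre, (rule total_within_wp)+, goal_cases)
      case (1 s)
      have *: "bval (in_bucket ''i'') s \<longleftrightarrow> \<not> c n < D - 1 \<and> bucket v i n"
        using 1 assms \<open>n < k\<close> by (auto simp: in_bucket_def bucket_def J_def holds_scores_def)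
      show ?case unfolding * using 1 \<open>n < k\<close> by (auto simp: J_def holds_scores_def)
    next
      case 2 show ?case by simp
    qed
  next
    case (2 n s)
    then show ?case by (simp add: J_def holds_scores_def)
  qed
  have "total_within (\<lambda>s. holds_scores k D v sc s \<and> nats s ''c'' = c \<and> nats s ''i'' 0 = i \<and>
        nats s ''y'' 0 = y \<and> nats s ''b'' 0 = b \<and> reals s ''best'' 0 = best)
     gain_prog (3 + k * 5) (J k)"
    unfolding gain_prog_def
    by (rule total_within_pre, rule total_within_Seq, rule total_within_Seq, rule loop, (rule total_within_wp)+)
      (auto simp: J_def holds_scores_def)
  then show ?thesis
    by (rule total_within_conseq) (auto simp: J_def gain_def)
qed

lemma best_prog_spec:
  assumes "0 < k" "\<And>i. i < k \<Longrightarrow> 0 \<le> sc i"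
  shows "total_within (\<lambda>s. holds_scores k D v sc s \<and> nats s ''c'' = c \<and> nats s ''y'' 0 = y)
     best_prog (4 + k * (9 + k * 5))
     (\<lambda>s. \<exists>b<k. holds_scores k D v sc s \<and> nats s ''c'' = c \<and> nats s ''y'' 0 = y \<and> nats s ''b'' 0 = b \<and>
        (\<forall>i<k. gain k D v sc c i \<le> gain k D v sc c b))"
proof -
  have nn: "0 \<le> gain k D v sc c i" for i
    unfolding gain_def using assms(2) by (intro sum_nonneg) auto
  \<comment> \<open>Only an inequality links \<open>best\<close> to the gain of \<open>b\<close>:
    initially \<open>best\<close> is 0 and \<open>b\<close> is 0, a valid index since 0 < k, whose
    gain is merely known to be nonnegative.\<close>
  define J where "J n s \<longleftrightarrow> holds_scores k D v sc s \<and> nats s ''c'' = c \<and> nats s ''i'' 0 = n \<and> nats s ''y'' 0 = y \<and>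
     nats s ''b'' 0 < k \<and> reals s ''best'' 0 \<le> gain k D v sc c (nats s ''b'' 0) \<and>
     (\<forall>i<n. gain k D v sc c i \<le> reals s ''best'' 0)" for n s
  let ?u = "Seq (If (RLess (rvar ''best'') (rvar ''sum''))
                    (Seq (rlet ''best'' (rvar ''sum'')) (NSet ''b'' (NConst 0) (nvar ''i''))) Skip) (inc ''i'')"
  have loop: "total_within (J 0) (While (NLess (nvar ''i'') (nvar ''k'')) (Seq gain_prog ?u))
      (1 + k * (8 + k * 5 + 1)) (J k)"
  proof (rule total_within_for, goal_cases)
    case (1 n)
    have "total_within (\<lambda>s. \<exists>b best. holds_scores k D v sc s \<and> nats s ''c'' = c \<and> nats s ''i'' 0 = n \<and> nats s ''y'' 0 = y \<and>
       nats s ''b'' 0 = b \<and> reals s ''best'' 0 = best \<and> b < k \<and> best \<le> gain k D v sc c b \<and>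
       (\<forall>i<n. gain k D v sc c i \<le> best)) (Seq gain_prog ?u) (3 + k * 5 + 5) (J (Suc n))"
    proof (intro total_within_ex)
      fix b best
      have "total_within (\<lambda>s. (b < k \<and> best \<le> gain k D v sc c b \<and> (\<forall>i<n. gain k D v sc c i \<le> best)) \<and>
         holds_scores k D v sc s \<and> nats s ''c'' = c \<and> nats s ''i'' 0 = n \<and>
         nats s ''y'' 0 = y \<and> nats s ''b'' 0 = b \<and> reals s ''best'' 0 = best \<and> reals s ''sum'' 0 = gain k D v sc c n)
         ?u 5 (J (Suc n))"
      proof (rule total_within_pre, (rule total_within_wp)+, goal_cases)
        case (1 s)
        then show ?case using \<open>n < k\<close> by (auto simp: J_def holds_scores_def less_Suc_eq intro: less_imp_le order_trans)
      next
        case 2 show ?case by simp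
      qed
      note tail = this
      show "total_within (\<lambda>s. holds_scores k D v sc s \<and> nats s ''c'' = c \<and> nats s ''i'' 0 = n \<and> nats s ''y'' 0 = y \<and>
       nats s ''b'' 0 = b \<and> reals s ''best'' 0 = best \<and> b < k \<and> best \<le> gain k D v sc c b \<and>
       (\<forall>i<n. gain k D v sc c i \<le> best)) (Seq gain_prog ?u) (3 + k * 5 + 5) (J (Suc n))"
      proof (cases "b < k \<and> best \<le> gain k D v sc c b \<and> (\<forall>i<n. gain k D v sc c i \<le> best)")
        case True
        show ?thesis
          by (rule total_within_pre[OF total_within_Seq'[OF tail gain_prog_spec[OF 1, of D v sc c y b best]]])
            (use True in \<open>auto simp: mult.commute\<close>)
      next
        case False
        then show ?thesis unfolding total_within_def by blast
      qed
    qed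
    then show ?case by (rule total_within_pre) (auto simp: J_def)
  next
    case (2 n s)
    then show ?case by (simp add: J_def holds_scores_def)
  qed
  have "total_within (\<lambda>s. holds_scores k D v sc s \<and> nats s ''c'' = c \<and> nats s ''y'' 0 = y)
     best_prog (4 + k * (9 + k * 5)) (J k)"
    unfolding best_prog_def
    by (rule total_within_pre, (rule total_within_Seq)+, rule loop, (rule total_within_wp)+)
      (auto simp: J_def holds_scores_def nn assms)
  then show ?thesis
    by (rule total_within_conseq) (auto simp: J_def intro: order_trans)
qed

lemma mark_prog_spec:
  assumes "b < k" "y < D - 1"
  shows "total_within (\<lambda>s. holds_scores k D v sc s \<and> nats s ''c'' = c \<and> nats s ''y'' 0 = y \<and> nats s ''b'' 0 = b)
     mark_prog (2 + k * 5)
     (\<lambda>s. holds_scores k D v sc s \<and> nats s ''y'' 0 = y \<and>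
        (\<forall>j<k. nats s ''c'' j = (if \<not> c j < D - 1 \<and> bucket v b j then y else c j)))"
proof -
  \<comment> \<open>Labels are overwritten in place. Cell \<open>n\<close> still carries its old
    label when it is tested, and bucket membership depends on \<open>v\<close> only.\<close>
  define J where "J n s \<longleftrightarrow> holds_scores k D v sc s \<and> nats s ''y'' 0 = y \<and> nats s ''b'' 0 = b \<and> nats s ''j'' 0 = n \<and>
     (\<forall>j<k. nats s ''c'' j = (if j < n \<and> \<not> c j < D - 1 \<and> bucket v b j then y else c j))" for n s
  have loop: "total_within (J 0) (While (NLess (nvar ''j'') (nvar ''k''))
           (Seq (If (in_bucket ''b'') (NSet ''c'' (nvar ''j'') (nvar ''y'')) Skip)
                (inc ''j''))) (1 + k * (4 + 1)) (J k)"
  proof (rule total_within_for, goal_cases)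
    case (1 n)
    show ?case
    proof (rule total_within_pre, (rule total_within_wp)+, goal_cases)
      case (1 s)
      have *: "bval (in_bucket ''b'') s \<longleftrightarrow> \<not> c n < D - 1 \<and> bucket v b n"
        using 1 assms \<open>n < k\<close> by (auto simp: in_bucket_def bucket_def J_def holds_scores_def)
      show ?case unfolding * using 1 \<open>n < k\<close> by (auto simp: J_def holds_scores_def less_Suc_eq)
    next
      case 2 show ?case by simp
    qed
  next
    case (2 n s)
    then show ?case by (simp add: J_def holds_scores_def)
  qed
  have "total_within (\<lambda>s. holds_scores k D v sc s \<and> nats s ''c'' = c \<and> nats s ''y'' 0 = y \<and> nats s ''b'' 0 = b)
     mark_prog (2 + k * 5) (J k)"
    unfolding mark_prog_def
    by (rule total_within_pre, rule total_within_Seq, rule loop, (rule total_within_wp)+)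
      (auto simp: J_def holds_scores_def)
  then show ?thesis
    by (rule total_within_conseq) (auto simp: J_def)
qed

lemma greedy_prog_spec:
  assumes "0 < k" "\<And>i. i < k \<Longrightarrow> 0 \<le> sc i"
  shows "total_within (\<lambda>s. holds_scores k D v sc s \<and> (\<forall>i<k. nats s ''c'' i = D - 1))
     greedy_prog (2 + (D - 1) * (8 + k * (14 + k * 5)))
     (\<lambda>s. holds_scores k D v sc s \<and> greedy k D v sc (D - 1) (nats s ''c''))"
proof -
  define J where "J y s \<longleftrightarrow> holds_scores k D v sc s \<and> nats s ''y'' 0 = y \<and> greedy k D v sc y (nats s ''c'')" for y s
  have loop: "total_within (J 0) (While (NLess (nvar ''y'') (NSub (nvar ''D'') (NConst 1)))
           (Seq best_prog (Seq mark_prog (inc ''y''))))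
      (1 + (D - 1) * (7 + k * (14 + k * 5) + 1)) (J (D - 1))"
  proof (rule total_within_for, goal_cases)
    case (1 y)
    have "total_within (\<lambda>s. \<exists>c. holds_scores k D v sc s \<and> nats s ''c'' = c \<and> nats s ''y'' 0 = y \<and> greedy k D v sc y c)
        (Seq best_prog (Seq mark_prog (inc ''y''))) (4 + k * (9 + k * 5) + (2 + k * 5 + 1)) (J (Suc y))"
    proof (intro total_within_ex)
      fix c
      show "total_within (\<lambda>s. holds_scores k D v sc s \<and> nats s ''c'' = c \<and> nats s ''y'' 0 = y \<and> greedy k D v sc y c)
        (Seq best_prog (Seq mark_prog (inc ''y''))) (4 + k * (9 + k * 5) + (2 + k * 5 + 1)) (J (Suc y))"
      proof (cases "greedy k D v sc y c")
        case g: True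
        have "total_within (\<lambda>s. \<exists>b. b < k \<and> holds_scores k D v sc s \<and> nats s ''c'' = c \<and> nats s ''y'' 0 = y \<and> nats s ''b'' 0 = b \<and>
            (\<forall>i<k. gain k D v sc c i \<le> gain k D v sc c b)) (Seq mark_prog (inc ''y'')) (2 + k * 5 + 1) (J (Suc y))"
        proof (intro total_within_ex)
          fix b
          show "total_within (\<lambda>s. b < k \<and> holds_scores k D v sc s \<and> nats s ''c'' = c \<and> nats s ''y'' 0 = y \<and> nats s ''b'' 0 = b \<and>
            (\<forall>i<k. gain k D v sc c i \<le> gain k D v sc c b)) (Seq mark_prog (inc ''y'')) (2 + k * 5 + 1) (J (Suc y))"
          proof (cases "b < k \<and> (\<forall>i<k. gain k D v sc c i \<le> gain k D v sc c b)")
            case True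
            have inc_y: "total_within (\<lambda>s. holds_scores k D v sc s \<and> nats s ''y'' 0 = y \<and>
                (\<forall>j<k. nats s ''c'' j = (if \<not> c j < D - 1 \<and> bucket v b j then y else c j)))
              (inc ''y'') 1 (J (Suc y))"
            proof (rule total_within_pre, rule total_within_NSet, goal_cases)
              case (1 s)
              then have "greedy k D v sc (Suc y) (nats s ''c'')"
                using True g \<open>y < D - 1\<close> by (intro greedy.step[of k D v sc y c b]) auto
              then show ?case using 1 by (auto simp: J_def holds_scores_def)
            qed simp
            have b: "b < k" using True by blast
            show ?thesis
              by (rule total_within_pre[OF total_within_Seq[OF inc_y mark_prog_spec[OF b 1, of v sc c]]]) auto
          next
            case False
            then show ?thesis unfolding total_within_def by blast
          qed
        qed
        from total_within_Seq'[OF this best_prog_spec[OF assms, where D = D and v = v and c = c and y = y]]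
        show ?thesis by (rule total_within_pre) auto
      next
        case False
        then show ?thesis unfolding total_within_def by blast
      qed
    qed
    then show ?case by (rule total_within_pre) (auto simp: J_def algebra_simps)
  next
    case (2 n s)
    then show ?case by (simp add: J_def holds_scores_def)
  qed
  have "total_within (\<lambda>s. holds_scores k D v sc s \<and> (\<forall>i<k. nats s ''c'' i = D - 1))
     greedy_prog (2 + (D - 1) * (8 + k * (14 + k * 5))) (J (D - 1))"
    unfolding greedy_prog_def
    by (rule total_within_pre, rule total_within_Seq, rule loop, (rule total_within_wp)+)
      (auto simp: J_def holds_scores_def intro: greedy.init)
  then show ?thesis
    by (rule total_within_conseq) (auto simp: J_def)
qed

lemma output_prog_spec:
  "total_within (\<lambda>s. holds_scores k D v sc s \<and> nats s ''c'' = c)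
     output_prog (3 + k * 4)
     (\<lambda>s. \<forall>z. reals s ''f'' z = (if \<exists>x<k. z = x * D + c x then 1 else 0))"
proof -
  define J where "J n s \<longleftrightarrow> nats s ''k'' 0 = k \<and> nats s ''D'' 0 = D \<and> nats s ''c'' = c \<and> nats s ''i'' 0 = n \<and>
     nats s ''x'' 0 = n * D \<and> (\<forall>z. reals s ''f'' z = (if \<exists>x<n. z = x * D + c x then 1 else 0))" for n and s :: store
  have loop: "total_within (J 0) (While (NLess (nvar ''i'') (nvar ''k''))
           (Seq (RSet ''f'' (NAdd (nvar ''x'') (NGet ''c'' (nvar ''i''))) (RConst 1))
           (Seq (NSet ''x'' (NConst 0) (NAdd (nvar ''x'') (nvar ''D'')))
                (inc ''i'')))) (1 + k * (3 + 1)) (J k)"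
  proof (rule total_within_for, goal_cases)
    case (1 n)
    show ?case
      by (rule total_within_pre, (rule total_within_wp)+) (auto simp: J_def less_Suc_eq)
  next
    case (2 n s)
    then show ?case by (simp add: J_def)
  qed
  have "total_within (\<lambda>s. holds_scores k D v sc s \<and> nats s ''c'' = c) output_prog (3 + k * 4) (J k)"
    unfolding output_prog_def
    by (rule total_within_pre, (rule total_within_Seq)+, rule loop, (rule total_within_wp)+)
      (auto simp: J_def holds_scores_def)
  then show ?thesis
    by (rule total_within_conseq) (auto simp: J_def)
qed

lemma quantizer_prog_spec:
  fixes \<pi> \<delta> :: real
  assumes "0 < \<pi>" "\<pi> < 1" "0 < \<delta>" "\<delta> < \<pi> / 4" "0 < k"
  defines "K \<equiv> nat \<lfloor>ln (1 / \<delta>)\<rfloor>"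
  shows "\<exists>t s M v sc c. run quantizer_prog (input_store k p q \<pi> \<delta> D) t s \<and>
     t \<le> 11 + 3 * K + k * (17 + 3 * K) + (D - 1) * (8 + k * (14 + k * 5)) \<and>
     1 \<le> M \<and> (\<delta> / \<pi>) ^ M \<le> \<pi> \<and> \<delta> < (\<delta> / \<pi>) ^ M \<and>
     (\<forall>i<k. scored M (pmf p i) (pmf q i) (v i) (sc i)) \<and> greedy k D v sc (D - 1) c \<and>
     (\<forall>z. reals s ''f'' z = (if \<exists>x<k. z = x * D + c x then 1 else 0))"
proof -
  let ?s0 = "input_store k p q \<pi> \<delta> D"
  have s0: "holds_input k D (pmf p) (pmf q) ?s0 \<and> reals ?s0 ''pi'' 0 = \<pi> \<and> reals ?s0 ''delta'' 0 = \<delta>"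
    by (simp add: holds_input_def input_store_def)
  obtain t1 s1 M where 1: "run level_prog ?s0 t1 s1" "t1 \<le> 4 + 3 * K" "1 \<le> M" "M \<le> K"
    "(\<delta> / \<pi>) ^ M \<le> \<pi>" "\<delta> < (\<delta> / \<pi>) ^ M" "holds_input k D (pmf p) (pmf q) s1" "reals s1 ''m'' 0 = real M"
    using level_prog_spec[OF assms(1,3,4,2), of k D "pmf p" "pmf q"] s0
    unfolding total_within_def K_def by blast
  obtain t2 s2 v sc where 2: "run score_prog s1 t2 s2" "t2 \<le> 2 + k * (13 + 3 * K)"
    "\<forall>i<k. scored M (pmf p i) (pmf q i) (v i) (sc i)" "holds_scores k D v sc s2" "\<forall>i<k. nats s2 ''c'' i = D - 1"
    using score_prog_spec[OF 1(3,4), where p = "pmf p" and q = "pmf q" and k = k and D = D, OF pmf_nonneg pmf_nonneg] 1(7,8)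
    unfolding total_within_def by blast
  have nn: "0 \<le> sc i" if "i < k" for i
    using scored_nonneg[of M "pmf p i" "pmf q i" "v i" "sc i"] 2(3) that by simp
  obtain t3 s3 where 3: "run greedy_prog s2 t3 s3" "t3 \<le> 2 + (D - 1) * (8 + k * (14 + k * 5))"
     "holds_scores k D v sc s3" "greedy k D v sc (D - 1) (nats s3 ''c'')"
    using greedy_prog_spec[OF assms(5), where sc = sc and D = D and v = v, OF nn] 2(4,5) unfolding total_within_def by blast
  obtain t4 s4 where 4: "run output_prog s3 t4 s4" "t4 \<le> 3 + k * 4"
     "\<forall>z. reals s4 ''f'' z = (if \<exists>x<k. z = x * D + nats s3 ''c'' x then 1 else 0)"
    using output_prog_spec[of k D v sc "nats s3 ''c''"] 3(3) unfolding total_within_def by blast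
  have "run quantizer_prog ?s0 (t1 + (t2 + (t3 + t4))) s4"
    unfolding quantizer_prog_def using 1(1) 2(1) 3(1) 4(1) by (intro run.Seq)
  moreover have "t1 + (t2 + (t3 + t4)) \<le> 11 + 3 * K + k * (17 + 3 * K) + (D - 1) * (8 + k * (14 + k * 5))"
    using add_mono[OF add_mono[OF 1(2) 2(2)] add_mono[OF 3(2) 4(2)]] by (simp add: algebra_simps)
  ultimately show ?thesis using 1(3,5,6) 2(3) 3(4) 4(3) by blast
qed

section \<open>From labels to a channel\<close>

lemma greedy_labels:
  assumes "greedy k D v sc y c" "j < k"
  shows "c j < y \<or> c j = D - 1"
  using assms
proof (induction arbitrary: j)
  case (init c)
  then show ?case by simp
next
  case (step y c b c')
  show ?case using step.hyps(5)[OF step.prems] step.IH[OF step.prems]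
    by (cases "\<not> c j < D - 1 \<and> bucket v b j") (auto simp: less_Suc_eq)
qed

lemma quantizer_prog_output:
  assumes "\<forall>z. reals s ''f'' z = (if \<exists>x<k. z = x * D + c x then 1 else 0)"
    "\<And>x. x < k \<Longrightarrow> c x < D"
  shows "outputs_channel k D s (\<lambda>x. return_pmf (c x + 1))"
  unfolding outputs_channel_def
proof (intro conjI allI impI ballI)
  show "(\<lambda>x. return_pmf (c x + 1)) \<in> channels {..<k} D"
    using assms(2) by (auto simp: channels_def Suc_leI)
  fix x y assume x: "x < k" and y: "y \<in> {1..D}"
  \<comment> \<open>Row-major addresses decode uniquely because columns stay below D. Labels start
    at 0 and channel outputs at 1, so column y - 1 is the label.\<close>
  have "x * D + (y - 1) = x' * D + c x' \<longleftrightarrow> x = x' \<and> y = c x + 1" if "x' < k" for x'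
  proof
    assume eq: "x * D + (y - 1) = x' * D + c x'"
    have w: "y - 1 < D" "c x' < D" using y assms(2)[OF that] by auto
    have "x = (x * D + (y - 1)) div D" using w(1)
      by (subst div_mult_self3) (simp_all only: div_less)
    moreover have "x' = (x' * D + c x') div D" using w(2) by simp
    ultimately have "x = x'" using eq by simp
    then show "x = x' \<and> y = c x + 1" using eq y by auto
  qed (use y in auto)
  then show "reals s ''f'' (x * D + (y - 1)) = pmf (return_pmf (c x + 1)) y"
    using assms(1) x by (auto simp: indicator_def)
qed

section \<open>Efficiency of the greedy quantizer\<close>

lemma greedy_cells:
  assumes "greedy k D v sc y c" "z < y"
  shows "\<exists>b<k. \<forall>j<k. c j = z \<longrightarrow> bucket v b j"
  using assms
proof (induction arbitrary: z)
  case (step y c b c')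
  show ?case
  proof (cases "z = y")
    case True
    \<comment> \<open>Before this round no point carried label y, since labels were below y or equal
      to D - 1 > y. So each point with label y was put there now.\<close>
    have "bucket v b j" if "j < k" "c' j = z" for j
      using step.hyps(5)[OF that(1)] greedy_labels[OF step.hyps(1) that(1)] that(2) step.hyps(2) True
      by (auto split: if_splits)
    then show ?thesis using step.hyps(3) by blast
  next
    case False
    then obtain b' where "b' < k" "\<forall>j<k. c j = z \<longrightarrow> bucket v b' j"
      using step.IH[of z] step.prems by auto
    moreover have "c j = z" if "j < k" "c' j = z" for j
      using step.hyps(5)[OF that(1)] that(2) False by (auto split: if_splits)
    ultimately show ?thesis by blast
  qed
qed simp

lemma greedy_cover_step:
  assumes "greedy k D v sc y c" "y < D - 1"
    "\<And>j. j < k \<Longrightarrow> c' j = (if \<not> c j < D - 1 \<and> bucket v b j then y else c j)"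
  shows "(\<Sum>j<k. if c' j < Suc y then sc j else 0) = (\<Sum>j<k. if c j < y then sc j else 0) + gain k D v sc c b"
  unfolding gain_def sum.distrib[symmetric]
proof (intro sum.cong refl)
  fix j assume "j \<in> {..<k}"
  then have j: "j < k" by simp
  show "(if c' j < Suc y then sc j else 0)
     = (if c j < y then sc j else 0) + (if \<not> c j < D - 1 \<and> bucket v b j then sc j else 0)"
    using assms(3)[OF j] greedy_labels[OF assms(1) j] assms(2) by auto
qed

text \<open>
  While less than half of \<open>sum sc U\<close> is covered, some class of \<open>key\<close> carries a \<open>1 / L\<close> fraction of the
  remaining half, and it lies in the bucket of its element with the smallest \<open>\<bar>v i\<bar>\<close>.
\<close>

lemma greedy_cover:
  fixes key :: "nat \<Rightarrow> 'b"
  assumes g: "greedy k D v sc y c" and sc: "\<And>j. j < k \<Longrightarrow> 0 \<le> sc j"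
    and U: "U \<subseteq> {..<k}" "0 < sum sc U"
    and key: "\<And>i j. i \<in> U \<Longrightarrow> j \<in> U \<Longrightarrow> key i = key j \<Longrightarrow> \<bar>v i\<bar> \<le> \<bar>v j\<bar> \<Longrightarrow> bucket v i j"
    and L: "real (card (key ` U)) \<le> L"
  shows "min (sum sc U / 2) (real y * sum sc U / (2 * L)) \<le> (\<Sum>j<k. if c j < y then sc j else 0)"
  using g
proof induction
  case (init c)
  then show ?case by simp
next
  case (step y c b c')
  define T where "T = sum sc U"
  let ?cov = "\<Sum>j<k. if c j < y then sc j else 0"
  have T: "T > 0" using U by (simp add: T_def)
  have fin: "finite U" using U finite_subset by blast
  have "U \<noteq> {}" using U by auto
  then have L0: "L > 0" using L fin by (metis card_gt_0_iff finite_imageI image_is_empty less_le_trans of_nat_0_less_iff)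
  have eq: "(\<Sum>j<k. if c' j < Suc y then sc j else 0) = ?cov + gain k D v sc c b"
    using greedy_cover_step[OF step.hyps(1,2,5)] .
  have gain0: "0 \<le> gain k D v sc c i" for i
    unfolding gain_def using sc by (intro sum_nonneg) auto
  show ?case
  proof (cases "T / 2 \<le> ?cov")
    case True
    then show ?thesis unfolding eq using gain0[of b] by (simp add: T_def)
  next
    case False
    define W where "W = {j \<in> U. \<not> c j < D - 1}"
    have "T = (\<Sum>j\<in>U. if c j < y then sc j else 0) + (\<Sum>j\<in>U. if \<not> c j < D - 1 then sc j else 0)"
      unfolding T_def sum.distrib[symmetric]
    proof (intro sum.cong refl)
      fix j assume "j \<in> U"
      then have j: "j < k" using U by auto
      show "sc j = (if c j < y then sc j else 0) + (if \<not> c j < D - 1 then sc j else 0)"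
        using greedy_labels[OF step.hyps(1) j] step.hyps(2) by auto
    qed
    also have "(\<Sum>j\<in>U. if c j < y then sc j else 0) \<le> ?cov"
      using U sc by (intro sum_mono2) auto
    also have "(\<Sum>j\<in>U. if \<not> c j < D - 1 then sc j else 0) = sum sc W"
      unfolding W_def using fin by (simp add: sum.If_cases Int_def)
    finally have W: "T / 2 < sum sc W" using False by simp
    have finW: "finite W" using fin by (simp add: W_def)
    \<comment> \<open>Pigeonhole: the unlabelled part of U carries more than T/2 and meets at most L
      classes.\<close>
    have "\<exists>\<kappa>\<in>key ` W. T / (2 * L) \<le> sum sc {j \<in> W. key j = \<kappa>}"
    proof (rule ccontr)
      assume "\<not> ?thesis"
      then have "\<And>\<kappa>. \<kappa> \<in> key ` W \<Longrightarrow> sum sc {j \<in> W. key j = \<kappa>} \<le> T / (2 * L)" by force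
      then have "(\<Sum>\<kappa>\<in>key ` W. sum sc {j \<in> W. key j = \<kappa>}) \<le> real (card (key ` W)) * (T / (2 * L))"
        by (rule sum_bounded_above)
      also have "\<dots> \<le> L * (T / (2 * L))"
      proof (intro mult_right_mono)
        have "card (key ` W) \<le> card (key ` U)"
          using fin by (intro card_mono) (auto simp: W_def)
        then show "real (card (key ` W)) \<le> L" using L by linarith
      qed (use T L0 in auto)
      also have "\<dots> = T / 2" using L0 by simp
      also have "(\<Sum>\<kappa>\<in>key ` W. sum sc {j \<in> W. key j = \<kappa>}) = sum sc W"
        using finW by (rule sum.image_gen[symmetric])
      finally show False using W by simp
    qed
    then obtain \<kappa> where \<kappa>: "\<kappa> \<in> key ` W" "T / (2 * L) \<le> sum sc {j \<in> W. key j = \<kappa>}" by blast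
    define V where "V = {j \<in> W. key j = \<kappa>}"
    have V: "finite V" "V \<noteq> {}" using finW \<kappa>(1) by (auto simp: V_def)
    define i where "i = arg_min_on (\<lambda>j. \<bar>v j\<bar>) V"
    have i: "i \<in> V" "\<And>j. j \<in> V \<Longrightarrow> \<bar>v i\<bar> \<le> \<bar>v j\<bar>"
      using arg_min_if_finite[OF V, of "\<lambda>j. \<bar>v j\<bar>"] unfolding i_def by (auto simp: not_less)
    have "sum sc V \<le> gain k D v sc c i"
      unfolding gain_def
    proof -
      have "sum sc V = (\<Sum>j\<in>V. if \<not> c j < D - 1 \<and> bucket v i j then sc j else 0)"
        using i key by (intro sum.cong) (auto simp: V_def W_def)
      also have "\<dots> \<le> (\<Sum>j<k. if \<not> c j < D - 1 \<and> bucket v i j then sc j else 0)"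
        using U sc by (intro sum_mono2) (auto simp: V_def W_def)
      finally show "sum sc V \<le> \<dots>" .
    qed
    also have "\<dots> \<le> gain k D v sc c b"
      using step.hyps(4)[of i] i(1) U by (auto simp: V_def W_def)
    finally have "T / (2 * L) \<le> gain k D v sc c b" using \<kappa>(2) by (simp add: V_def)
    moreover have "real y * T / (2 * L) \<le> ?cov"
      using step.IH False by (simp add: T_def)
    moreover have "real (Suc y) * T / (2 * L) = real y * T / (2 * L) + T / (2 * L)"
      by (simp add: algebra_simps add_divide_distrib)
    ultimately show ?thesis unfolding eq T_def[symmetric] by linarith
  qed
qed

text \<open>The added range of \<open>v\<close> separates the two regimes: values near ratio 1
  exceed -1/3, while levels are at most -1. A bucket spans a factor below 2, so it cannot contain
  both kinds.\<close>

lemma scored_cases: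
  assumes "scored M p q v sc" "0 \<le> p" "0 \<le> q"
  obtains (near) "p < 2 * q" "v = (q - p) / (p + q)" "sc = v * v * (p + q)" "- 1/3 < v" "v \<le> 1"
  | (level) l where "1 \<le> l" "l \<le> M" "2 * q \<le> p" "2 ^ l * q \<le> p" "p < 2 ^ (l + 1) * q \<or> l = M"
      "v = - real l" "sc = p * real l"
  using assms(1) unfolding scored_def
proof
  assume "p < 2 * q \<and> v = (q - p) / (p + q) \<and> sc = v * v * (p + q)"
  then have h: "p < 2 * q" "v = (q - p) / (p + q)" "sc = v * v * (p + q)" by auto
  have pos: "p + q > 0" using h(1) assms by linarith
  have "- 1/3 < v" unfolding h(2) pos_less_divide_eq[OF pos] using h(1) by (simp add: field_simps)
  moreover have "v \<le> 1" unfolding h(2) pos_divide_le_eq[OF pos] using assms(2,3) by simp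
  ultimately show ?thesis using near h by blast
qed (use level in blast)

text \<open>The factor 3 covers both regimes: the square bound costs 3, the level bound 2.\<close>

lemma skew_gap_le_score:
  assumes "scored M p q v sc" "0 \<le> p" "0 \<le> q" "1 \<le> M"
  shows "skew_gap (1 / (2 * real M)) p q \<le> 3 * (1 / (2 * real M)) * sc"
  using assms(1-3)
proof (cases rule: scored_cases)
  case near
  have "p + q > 0" using near assms by linarith
  then have "sc = (q - p)\<^sup>2 / (p + q)" unfolding near by (simp add: power2_eq_square)
  moreover have "1 / (2 * real M) \<le> 1 / 2" using assms(4) by simp
  ultimately show ?thesis
    using skew_gap_le_square[of p q "1 / (2 * real M)"] assms near by simp
next
  case (level l)
  have "skew_gap (1 / (2 * real M)) p q \<le> 1 / (2 * real M) * (2 * real l * p)"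
    using level assms by (intro skew_gap_le_level) auto
  also have "\<dots> \<le> 1 / (2 * real M) * (3 * real l * p)"
    using assms by (intro mult_left_mono mult_right_mono) auto
  finally show ?thesis by (simp add: level mult_ac)
qed

text \<open>Merging is harmless within a bucket. Near ratio 1 the differences q - p share a sign, so
  nothing cancels and the merged pair satisfies |Q - P| >= a (P + Q), where a is the absolute value
  of \<open>v b\<close>; the scores sum to at most 4 a^2 (P + Q). On the levels, 2^r q <= p is
  preserved by addition, and the scores sum to at most 2 r P. This factor 2 and the 1/12 of the
  level bound give 1/24; the near case would allow 1/8.\<close>

lemma skew_gap_cell:
  assumes scored: "\<And>j. j < k \<Longrightarrow> scored M (p j) (q j) (v j) (sc j)"
    and pq: "\<And>j. 0 \<le> p j" "\<And>j. 0 \<le> q j" and M: "1 \<le> M"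
    and b: "b < k" and Z: "Z \<subseteq> {..<k}" "\<And>j. j \<in> Z \<Longrightarrow> bucket v b j"
  shows "1 / (2 * real M) / 24 * sum sc Z \<le> skew_gap (1 / (2 * real M)) (sum p Z) (sum q Z)"
proof -
  define l where "l = 1 / (2 * real M)"
  have l: "0 < l" "l \<le> 1/2" using M by (auto simp: l_def)
  define P Q where "P = sum p Z" and "Q = sum q Z"
  have PQ: "0 \<le> P" "0 \<le> Q" using pq by (auto simp: P_def Q_def sum_nonneg)
  from scored[OF b] pq(1)[of b] pq(2)[of b] have "l / 24 * sum sc Z \<le> skew_gap l P Q"
  proof (cases rule: scored_cases)
    case near
    define a where "a = \<bar>v b\<bar>"
    have j: "p j < 2 * q j \<and> v j = (q j - p j) / (p j + q j) \<and> sc j = v j * v j * (p j + q j) \<and>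
        a \<le> \<bar>v j\<bar> \<and> \<bar>v j\<bar> \<le> 2 * a \<and> 0 < v b * v j" if "j \<in> Z" for j
    proof -
      have bk: "v b * v b \<le> v b * v j" "v b * v j < 2 * (v b * v b)"
        using Z(2)[OF that] by (auto simp: bucket_def)
      have nz: "v b \<noteq> 0" using bk by auto
      then have pos: "0 < v b * v b" by (simp add: zero_less_mult_iff linorder_neq_iff disj_commute)
      have s: "0 < v b * v j" using bk pos by linarith
      then have ab: "v b * v j = a * \<bar>v j\<bar>" "v b * v b = a * a"
        by (auto simp: a_def abs_mult[symmetric])
      have a: "a > 0" using nz by (simp add: a_def)
      have aj: "a \<le> \<bar>v j\<bar>" "\<bar>v j\<bar> < 2 * a"
        using bk a unfolding ab by (auto simp: mult.assoc[symmetric] mult_less_cancel_right mult_le_cancel_left)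
      have "j < k" using that Z by auto
      from scored[OF this] pq(1)[of j] pq(2)[of j] show ?thesis
      proof (cases rule: scored_cases)
        case near
        then show ?thesis using aj s by simp
      next
        case (level l')
        \<comment> \<open>A level point has \<open>v j\<close> at most -1, but a negative
          \<open>v b\<close> exceeds -1/3, which bounds the absolute value of \<open>v j\<close> by
          2/3.\<close>
        then have vj: "v j \<le> -1" by simp
        moreover have "v b < 0" using s vj by (auto simp: zero_less_mult_iff)
        ultimately show ?thesis using aj(2) near(4) by (auto simp: a_def)
      qed
    qed
    have "a * (P + Q) \<le> \<bar>Q - P\<bar>"
    proof -
      have tau: "\<bar>q j - p j\<bar> = \<bar>v j\<bar> * (p j + q j)" if "j \<in> Z" for j
      proof -
        have "p j + q j > 0" using j[OF that] pq[of j] pq(2)[of j] by linarith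
        moreover have "v j = (q j - p j) / (p j + q j)" using j[OF that] by blast
        ultimately show ?thesis by simp
      qed
      have "a * (P + Q) = (\<Sum>j\<in>Z. a * (p j + q j))"
        by (simp add: P_def Q_def flip: sum.distrib sum_distrib_left)
      also have "\<dots> \<le> (\<Sum>j\<in>Z. \<bar>q j - p j\<bar>)"
      proof (intro sum_mono)
        fix i assume i: "i \<in> Z"
        have "a \<le> \<bar>v i\<bar>" using j[OF i] by blast
        then show "a * (p i + q i) \<le> \<bar>q i - p i\<bar>"
          unfolding tau[OF i] using pq(1)[of i] pq(2)[of i] by (intro mult_right_mono) auto
      qed
      also have "\<dots> = \<bar>Q - P\<bar>"
      proof (cases "v b > 0")
        case True
        have "q j - p j \<ge> 0" if "j \<in> Z" for j
        proof -
          have "v j > 0" using j[OF that] True by (simp add: zero_less_mult_iff)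
          moreover have "p j + q j > 0" using j[OF that] pq[of j] pq(2)[of j] by linarith
          ultimately have "0 < q j - p j" using j[OF that] by (simp only: zero_less_divide_iff) linarith
          then show ?thesis by simp
        qed
        then have "(\<Sum>j\<in>Z. \<bar>q j - p j\<bar>) = Q - P" "0 \<le> Q - P"
          by (auto simp: P_def Q_def sum_subtractf[symmetric] sum_nonneg intro: sum.cong)
        then show ?thesis by simp
      next
        case False
        have "q j - p j \<le> 0" if "j \<in> Z" for j
        proof -
          have "v j < 0" using j[OF that] False by (auto simp: zero_less_mult_iff)
          moreover have "p j + q j > 0" using j[OF that] pq[of j] pq(2)[of j] by linarith
          ultimately have "q j - p j < 0" using j[OF that] by (simp only: divide_less_0_iff) linarith
          then show ?thesis by simp
        qed
        then have "(\<Sum>j\<in>Z. \<bar>q j - p j\<bar>) = P - Q" "0 \<le> P - Q"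
          by (auto simp: P_def Q_def sum_subtractf[symmetric] sum_nonneg intro: sum.cong)
        then show ?thesis by simp
      qed
      finally show ?thesis .
    qed
    then have "(a * (P + Q))\<^sup>2 \<le> (P - Q)\<^sup>2"
      using power_mono[of "a * (P + Q)" "\<bar>Q - P\<bar>" 2] PQ
      by (simp add: a_def power2_commute)
    then have "a\<^sup>2 * (P + Q) \<le> (P - Q)\<^sup>2 / (P + Q)"
      using PQ by (cases "P + Q = 0") (auto simp: field_simps power2_eq_square add_nonneg_eq_0_iff)
    then have "l / 2 * (a\<^sup>2 * (P + Q)) \<le> l / 2 * ((P - Q)\<^sup>2 / (P + Q))"
      using l by (intro mult_left_mono) auto
    then have 1: "l / 2 * (a\<^sup>2 * (P + Q)) \<le> skew_gap l P Q"
      using skew_gap_ge_square[OF PQ l] by (rule order_trans)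
    have "sum sc Z \<le> (\<Sum>j\<in>Z. 4 * a\<^sup>2 * (p j + q j))"
    proof (intro sum_mono)
      fix i assume i: "i \<in> Z"
      have "\<bar>v i\<bar> * \<bar>v i\<bar> \<le> (2 * a) * (2 * a)"
        using j[OF i] by (intro mult_mono) auto
      then have "v i * v i \<le> 4 * a\<^sup>2" by (simp add: power2_eq_square)
      then have "v i * v i * (p i + q i) \<le> 4 * a\<^sup>2 * (p i + q i)"
        using pq(1)[of i] pq(2)[of i] by (intro mult_right_mono) auto
      then show "sc i \<le> 4 * a\<^sup>2 * (p i + q i)" using j[OF i] by simp
    qed
    also have "\<dots> = 4 * a\<^sup>2 * (P + Q)" by (simp add: P_def Q_def flip: sum.distrib sum_distrib_left)
    finally have "l / 24 * sum sc Z \<le> l / 24 * (4 * a\<^sup>2 * (P + Q))"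
      using l by (intro mult_left_mono) auto
    also have "\<dots> \<le> l / 2 * (a\<^sup>2 * (P + Q))"
    proof -
      have "0 \<le> l * (a\<^sup>2 * (P + Q))" using l PQ by simp
      then show ?thesis by (simp add: mult_ac)
    qed
    finally show ?thesis using 1 by simp
  next
    case (level r)
    have j: "2 ^ r * q j \<le> p j \<and> sc j \<le> 2 * real r * p j" if "j \<in> Z" for j
    proof -
      have bk: "v b * v b \<le> v b * v j" "v b * v j < 2 * (v b * v b)"
        using Z(2)[OF that] by (auto simp: bucket_def)
      have r0: "real r > 0" using level by simp
      have vj: "real r \<le> - v j" "- v j < 2 * real r"
      proof -
        have "real r * real r \<le> real r * (- v j)" "real r * (- v j) < real r * (2 * real r)"
          using bk unfolding level by (simp_all add: algebra_simps)
        then show "real r \<le> - v j" "- v j < 2 * real r"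
          using r0 by (simp_all only: mult_le_cancel_left_pos mult_less_cancel_left_pos)
      qed
      have "j < k" using that Z by auto
      from scored[OF this] pq(1)[of j] pq(2)[of j] show ?thesis
      proof (cases rule: scored_cases)
        case near
        then show ?thesis using vj(1) level(1) by simp
      next
        case (level s)
        then have s: "r \<le> s" "real s \<le> 2 * real r" using vj by auto
        have "2 ^ r * q j \<le> 2 ^ s * q j"
          using s(1) pq(2)[of j] by (intro mult_right_mono power_increasing) auto
        then have "2 ^ r * q j \<le> p j" using level by linarith
        moreover have "p j * real s \<le> p j * (2 * real r)" using s pq by (intro mult_left_mono) auto
        ultimately show ?thesis using level by (simp add: mult_ac)
      qed
    qed
    have "2 ^ r * Q \<le> P" unfolding P_def Q_def sum_distrib_left using j by (intro sum_mono) auto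
    then have 1: "l * (real r * P) / 12 \<le> skew_gap l P Q"
      unfolding l_def using level PQ by (intro skew_gap_ge_level) auto
    have "sum sc Z \<le> 2 * real r * P"
      unfolding P_def sum_distrib_left using j by (intro sum_mono) auto
    then have "l / 24 * sum sc Z \<le> l / 24 * (2 * real r * P)"
      using l by (intro mult_left_mono) auto
    then show ?thesis using 1 by (simp add: mult_ac)
  qed
  then show ?thesis by (simp add: l_def P_def Q_def)
qed

section \<open>From covered score to the affinity of the quantized pair\<close>

lemma sum_skew_gap_pmf:
  assumes "finite A" "set_pmf p \<subseteq> A" "set_pmf q \<subseteq> A"
  shows "(\<Sum>x\<in>A. skew_gap l (pmf p x) (pmf q x)) = 1 - affinity l A p q"
proof -
  have "(\<Sum>x\<in>A. skew_gap l (pmf p x) (pmf q x))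
      = (1 - l) * (\<Sum>x\<in>A. pmf p x) + l * (\<Sum>x\<in>A. pmf q x) - affinity l A p q"
    by (simp add: skew_gap_def affinity_def sum.distrib sum_subtractf sum_distrib_left)
  then show ?thesis using assms by (simp add: sum_pmf_eq_1)
qed

text \<open>Restricted to points that are not too close to ratio 1, the score falls into
  O(ln(n/\<pi>)) classes, each contained in a bucket. Covering then grows linearly with the number
  of rounds until half of that score is reached.\<close>

lemma greedy_score_cover:
  fixes n \<pi> :: real and p q :: "nat pmf"
  assumes g: "greedy k D v sc (D - 1) c" and D: "D \<ge> 2"
    and sc: "\<And>j. j < k \<Longrightarrow> scored M (pmf p j) (pmf q j) (v j) (sc j)"
    and supp: "set_pmf p \<subseteq> {..<k}" "set_pmf q \<subseteq> {..<k}"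
    and M: "1 \<le> M" "\<pi> \<le> (1/4) ^ (M - 1)" and \<pi>: "0 < \<pi>" "\<pi> \<le> 1/2" and n: "1 \<le> n"
    and S: "1 / (200 * n) \<le> sum sc {..<k}"
  shows "sum sc {..<k} / (200 * max 1 (ln (n / \<pi>) / real D)) \<le> (\<Sum>j<k. if c j < D - 1 then sc j else 0)"
proof -
  define T0 where "T0 = sum sc {..<k}"
  have T0: "T0 > 0" using S n by (auto simp: T0_def intro: less_le_trans[rotated])
  \<comment> \<open>Points below \<epsilon> have score at most \<epsilon>^2 (p + q), and p + q has
    total mass 2, so T0/4 per unit mass leaves them at most T0/2. The cap 1 keeps level points out
    of this estimate.\<close>
  define \<epsilon> where "\<epsilon> = min 1 (sqrt T0 / 2)"
  have \<epsilon>: "0 < \<epsilon>" "\<epsilon> \<le> 1" "\<epsilon>\<^sup>2 \<le> T0 / 4"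
  proof -
    show "0 < \<epsilon>" "\<epsilon> \<le> 1" using T0 by (auto simp: \<epsilon>_def)
    have "\<epsilon>\<^sup>2 \<le> (sqrt T0 / 2)\<^sup>2" using \<open>0 < \<epsilon>\<close> by (intro power_mono) (auto simp: \<epsilon>_def)
    then show "\<epsilon>\<^sup>2 \<le> T0 / 4" using T0 by (simp add: power_divide)
  qed
  \<comment> \<open>points below \<open>\<epsilon>\<close> carry at most half of the score, the others span few dyadic scales\<close>
  define U where "U = {j \<in> {..<k}. \<epsilon> \<le> \<bar>v j\<bar>}"
  \<comment> \<open>Equal keys mean equal sign and a ratio of absolute values below 2. Buckets are
    not aligned to this dyadic grid; they start at the smallest element of a class.\<close>
  define key where "key j = (0 < v j, \<lfloor>log 2 \<bar>v j\<bar>\<rfloor>)" for j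
  have sc0: "0 \<le> sc j" if "j < k" for j
    using scored_nonneg[OF sc[OF that]] by simp
  have vM: "\<bar>v j\<bar> \<le> real M" if "j < k" for j
    using sc[OF that] pmf_nonneg pmf_nonneg
  proof (cases rule: scored_cases)
    case near
    then show ?thesis using M by linarith
  qed auto
  have small: "sc j \<le> T0 / 4 * (pmf p j + pmf q j)" if "j < k" "\<not> \<epsilon> \<le> \<bar>v j\<bar>" for j
    using sc[OF that(1)] pmf_nonneg pmf_nonneg
  proof (cases rule: scored_cases)
    case near
    have "v j * v j \<le> \<epsilon>\<^sup>2"
      using that(2) mult_mono[of "\<bar>v j\<bar>" \<epsilon> "\<bar>v j\<bar>" \<epsilon>] by (simp add: power2_eq_square)
    then have "v j * v j * (pmf p j + pmf q j) \<le> T0 / 4 * (pmf p j + pmf q j)"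
      using \<epsilon>(3) by (intro mult_right_mono) auto
    then show ?thesis using near by simp
  next
    case (level l)
    then show ?thesis using that(2) \<epsilon>(2) by simp
  qed
  have "U \<subseteq> {..<k}" by (auto simp: U_def)
  then have "T0 = sum sc U + (\<Sum>j\<in>{..<k} - U. sc j)"
    unfolding T0_def using sum.subset_diff[of U "{..<k}" sc] by simp
  also have "(\<Sum>j\<in>{..<k} - U. sc j) \<le> (\<Sum>j\<in>{..<k} - U. T0 / 4 * (pmf p j + pmf q j))"
    by (intro sum_mono small) (auto simp: U_def)
  also have "\<dots> \<le> (\<Sum>j<k. T0 / 4 * (pmf p j + pmf q j))"
    using T0 by (intro sum_mono2) (auto intro!: mult_nonneg_nonneg)
  also have "\<dots> = T0 / 4 * (sum (pmf p) {..<k} + sum (pmf q) {..<k})"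
    by (simp only: sum_distrib_left[symmetric] sum.distrib)
  also have "\<dots> = T0 / 2" using supp by (simp add: sum_pmf_eq_1)
  finally have U: "T0 / 2 \<le> sum sc U" by simp
  have bucket: "bucket v i j" if "i \<in> U" "j \<in> U" "key i = key j" "\<bar>v i\<bar> \<le> \<bar>v j\<bar>" for i j
  proof -
    have pos: "0 < \<bar>v i\<bar>" "0 < \<bar>v j\<bar>" using that \<epsilon> by (auto simp: U_def)
    have "log 2 \<bar>v j\<bar> < log 2 \<bar>v i\<bar> + 1"
    proof -
      have "\<lfloor>log 2 \<bar>v i\<bar>\<rfloor> = \<lfloor>log 2 \<bar>v j\<bar>\<rfloor>" using that(3) by (simp add: key_def)
      then show ?thesis by linarith
    qed
    also have "\<dots> = log 2 (2 * \<bar>v i\<bar>)" using pos by (simp add: log_mult)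
    finally have "\<bar>v j\<bar> < 2 * \<bar>v i\<bar>" using pos by simp
    then have "\<bar>v i\<bar> * \<bar>v j\<bar> < \<bar>v i\<bar> * (2 * \<bar>v i\<bar>)"
      using pos by (intro mult_strict_left_mono)
    moreover have "\<bar>v i\<bar> * \<bar>v i\<bar> \<le> \<bar>v i\<bar> * \<bar>v j\<bar>"
      using that(4) by (intro mult_left_mono) auto
    moreover have "v i * v j = \<bar>v i\<bar> * \<bar>v j\<bar>" "v i * v i = \<bar>v i\<bar> * \<bar>v i\<bar>"
      using that(3) by (auto simp: key_def abs_if)
    ultimately show ?thesis
      unfolding bucket_def by linarith
  qed
  define L where "L = 23 * ln (n / \<pi>)"
  have npi: "2 \<le> n / \<pi>"
  proof -
    have "2 * \<pi> \<le> n" using \<pi> n by linarith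
    then show ?thesis using \<pi> by (simp add: le_divide_eq)
  qed
  have ln_pos: "ln (n / \<pi>) > 0" using npi by (intro ln_gt_zero) auto
  have card: "real (card (key ` U)) \<le> L"
  proof -
    have "key ` U \<subseteq> UNIV \<times> {\<lfloor>log 2 \<epsilon>\<rfloor>..\<lfloor>log 2 (real M)\<rfloor>}"
    proof (rule image_subsetI)
      fix j assume "j \<in> U"
      then have j: "\<epsilon> \<le> \<bar>v j\<bar>" "\<bar>v j\<bar> \<le> real M" using vM by (auto simp: U_def)
      then have "log 2 \<epsilon> \<le> log 2 \<bar>v j\<bar>" "log 2 \<bar>v j\<bar> \<le> log 2 (real M)"
        using \<epsilon> by (auto intro!: log_mono)
      then show "key j \<in> UNIV \<times> {\<lfloor>log 2 \<epsilon>\<rfloor>..\<lfloor>log 2 (real M)\<rfloor>}"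
        by (auto simp: key_def intro: floor_mono)
    qed
    then have "card (key ` U) \<le> card ((UNIV :: bool set) \<times> {\<lfloor>log 2 \<epsilon>\<rfloor>..\<lfloor>log 2 (real M)\<rfloor>})"
      by (intro card_mono) auto
    also have "\<dots> = 2 * nat (\<lfloor>log 2 (real M)\<rfloor> - \<lfloor>log 2 \<epsilon>\<rfloor> + 1)"
      by (simp add: card_cartesian_product)
    finally have "real (card (key ` U)) \<le> 2 * real (nat (\<lfloor>log 2 (real M)\<rfloor> - \<lfloor>log 2 \<epsilon>\<rfloor> + 1))"
      by (metis of_nat_le_iff of_nat_mult of_nat_numeral)
    also have "\<dots> \<le> 2 * (log 2 (real M) - log 2 \<epsilon> + 2)"
    proof -
      have "log 2 \<epsilon> \<le> log 2 (real M)" using \<epsilon> M by (intro log_mono) auto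
      then have "\<lfloor>log 2 \<epsilon>\<rfloor> \<le> \<lfloor>log 2 (real M)\<rfloor>" by (rule floor_mono)
      then have "real (nat (\<lfloor>log 2 (real M)\<rfloor> - \<lfloor>log 2 \<epsilon>\<rfloor> + 1)) = of_int \<lfloor>log 2 (real M)\<rfloor> - of_int \<lfloor>log 2 \<epsilon>\<rfloor> + 1"
        by simp
      also have "\<dots> \<le> log 2 (real M) - log 2 \<epsilon> + 2" by linarith
      finally show ?thesis by simp
    qed
    finally have c1: "real (card (key ` U)) \<le> 2 * (log 2 (real M) - log 2 \<epsilon> + 2)" .
    \<comment> \<open>A crude bound suffices: M <= 2^(M-1), while 4^(M-1) <= 1/\<pi>. The factor 1/2
      is offset by the two signs.\<close>
    have c2: "log 2 (real M) \<le> log 2 (1 / \<pi>) / 2"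
    proof -
      have "M - 1 < 2 ^ (M - 1)" by (rule less_exp)
      then have "real M \<le> 2 ^ (M - 1)" using M(1) by (metis Suc_leI Suc_pred' less_eq_Suc_le One_nat_def of_nat_le_iff of_nat_power of_nat_numeral)
      then have "log 2 (real M) \<le> log 2 (2 ^ (M - 1))" using M(1) by (intro log_mono) auto
      also have "\<dots> = real (M - 1)" by (simp add: log_nat_power)
      also have "real (M - 1) = log 2 (4 ^ (M - 1)) / 2"
      proof -
        have "(4::real) ^ (M - 1) = 2 ^ (2 * (M - 1))" by (simp add: power_mult)
        then show ?thesis by (simp add: log_nat_power)
      qed
      also have "log 2 (4 ^ (M - 1)) \<le> log 2 (1 / \<pi>)"
        using M(2) \<pi> by (intro log_mono) (auto simp: field_simps)
      finally show ?thesis by simp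
    qed
    \<comment> \<open>T0 >= 1/(200 n) >= 1/(256 n); the square root gives 1/(16 sqrt n), the halving
      in \<epsilon> makes it 32 = 2^5.\<close>
    have c3: "- log 2 \<epsilon> \<le> log 2 n / 2 + 5"
    proof -
      have "1 / (32 * sqrt n) \<le> \<epsilon>"
      proof -
        have "1 \<le> sqrt n" using n by simp
        then have "1 \<le> 32 * sqrt n" by linarith
        then have "1 / (32 * sqrt n) \<le> 1" by (intro divide_le_eq_1_pos[THEN iffD2]) linarith+
        moreover have "1 / (32 * sqrt n) \<le> sqrt T0 / 2"
        proof -
          have "(1 / (16 * sqrt n))\<^sup>2 \<le> T0"
            using S n by (simp add: T0_def power_divide power_mult_distrib) (smt (verit) frac_le)
          then have "1 / (16 * sqrt n) \<le> sqrt T0" by (rule real_le_rsqrt)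
          then show ?thesis by simp
        qed
        ultimately show ?thesis by (simp add: \<epsilon>_def)
      qed
      then have "log 2 (1 / (32 * sqrt n)) \<le> log 2 \<epsilon>" using n by (intro log_mono) auto
      moreover have "log 2 (1 / (32 * sqrt n)) = - (5 + log 2 n / 2)"
      proof -
        have "log 2 (32::real) = 5" using log_nat_power[of 2 2 5] by simp
        moreover have "log 2 (sqrt n) = log 2 n / 2" using n by (simp add: log_def ln_sqrt)
        ultimately show ?thesis using n by (simp add: log_divide log_mult)
      qed
      ultimately show ?thesis by simp
    qed
    have "real (card (key ` U)) \<le> 2 * (log 2 (1 / \<pi>) / 2 + (log 2 n / 2 + 5) + 2)"
      using c1 c2 c3 by argo
    also have "\<dots> = log 2 (n / \<pi>) + 14" using n \<pi> by (simp add: log_divide)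
    also have "\<dots> \<le> 15 * log 2 (n / \<pi>)"
    proof -
      have "log 2 2 \<le> log 2 (n / \<pi>)" using npi by (intro log_mono) auto
      then show ?thesis by simp
    qed
    also have "\<dots> \<le> L"
    proof -
      have "15 \<le> 23 * ln (2::real)" using ln2_ge_two_thirds by simp
      then have "15 * ln (n / \<pi>) \<le> 23 * ln 2 * ln (n / \<pi>)" using ln_pos by (intro mult_right_mono) auto
      then show ?thesis by (simp add: L_def log_def field_simps)
    qed
    finally show ?thesis by simp
  qed
  define X where "X = max 1 (ln (n / \<pi>) / real D)"
  have X: "1 \<le> X" "ln (n / \<pi>) / real D \<le> X" by (auto simp: X_def)
  have "min (sum sc U / 2) (real (D - 1) * sum sc U / (2 * L)) \<le> (\<Sum>j<k. if c j < D - 1 then sc j else 0)"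
    using U T0 by (intro greedy_cover[OF g sc0 _ _ bucket card]) (auto simp: U_def)
  moreover have "T0 / (200 * X) \<le> sum sc U / 2"
  proof -
    have "T0 / (200 * X) \<le> T0 / 4" using T0 X by (intro divide_left_mono) auto
    then show ?thesis using U by linarith
  qed
  moreover have "T0 / (200 * X) \<le> real (D - 1) * sum sc U / (2 * L)"
  proof -
    \<comment> \<open>184 = 8 * 23: the 23 of L, the 2 in the covering bound, D - 1 >= D/2, and U
      holding half of T0.\<close>
    have "T0 / (200 * X) \<le> T0 / (184 * (ln (n / \<pi>) / real D))"
      using T0 X ln_pos D by (intro divide_left_mono) auto
    also have "\<dots> = (real D / 2) * (T0 / 2) / (2 * L)"
      using ln_pos D by (simp add: L_def field_simps)
    also have "\<dots> \<le> real (D - 1) * sum sc U / (2 * L)"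
      using U T0 D ln_pos by (intro divide_right_mono mult_mono) (auto simp: L_def)
    finally show ?thesis .
  qed
  ultimately show ?thesis unfolding T0_def[symmetric] X_def[symmetric] by linarith
qed

text \<open>Each of the first D - 1 cells lies inside one bucket and retains its score up to a
  constant. The cell of the last label is arbitrary; its deficit is nonnegative and is
  discarded.\<close>

lemma affinity_map_le:
  fixes p q :: "nat pmf"
  assumes g: "greedy k D v sc (D - 1) c" and D: "D \<ge> 2"
    and sc: "\<And>j. j < k \<Longrightarrow> scored M (pmf p j) (pmf q j) (v j) (sc j)"
    and supp: "set_pmf p \<subseteq> {..<k}" "set_pmf q \<subseteq> {..<k}" and M: "1 \<le> M"
  defines "f \<equiv> \<lambda>x. c x + 1" and "l \<equiv> 1 / (2 * real M)"
  shows "affinity l {1..D} (map_pmf f p) (map_pmf f q)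
      \<le> 1 - l / 24 * (\<Sum>j<k. if c j < D - 1 then sc j else 0)"
proof -
  have l: "0 < l" "l \<le> 1/2" using M by (auto simp: l_def)
  have cD: "c j < D" if "j < k" for j using greedy_labels[OF g that] D by auto
  define Z where "Z z = {j \<in> {..<k}. c j = z}" for z
  have pmf_f: "pmf (map_pmf f r) (z + 1) = sum (pmf r) (Z z)" if "set_pmf r \<subseteq> {..<k}" for r z
  proof -
    have "pmf (map_pmf f r) (z + 1) = (\<Sum>x<k. if x \<in> f -` {z + 1} then pmf r x else 0)"
      unfolding pmf_map by (rule prob_finite_support[OF _ that]) simp
    also have "\<dots> = sum (pmf r) (Z z)"
      by (simp add: Z_def f_def sum.If_cases Int_def)
    finally show ?thesis .
  qed
  have supp_f: "set_pmf (map_pmf f r) \<subseteq> {1..D}" if "set_pmf r \<subseteq> {..<k}" for r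
    using that cD by (fastforce simp: f_def Suc_le_eq)
  have "(\<Sum>j<k. if c j < D - 1 then sc j else 0) = (\<Sum>j\<in>{j\<in>{..<k}. c j < D - 1}. sc j)"
    by (simp add: sum.If_cases Int_def)
  also have "\<dots> = (\<Sum>z\<in>{..<D - 1}. \<Sum>j\<in>{j\<in>{j\<in>{..<k}. c j < D - 1}. c j = z}. sc j)"
    by (rule sum.group[symmetric]) auto
  also have "\<dots> = (\<Sum>z\<in>{..<D - 1}. sum sc (Z z))"
    by (intro sum.cong) (auto simp: Z_def)
  finally have "l / 24 * (\<Sum>j<k. if c j < D - 1 then sc j else 0) = (\<Sum>z\<in>{..<D - 1}. l / 24 * sum sc (Z z))"
    by (simp add: sum_distrib_left)
  also have "\<dots> \<le> (\<Sum>z\<in>{..<D - 1}. skew_gap l (pmf (map_pmf f p) (z + 1)) (pmf (map_pmf f q) (z + 1)))"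
  proof (intro sum_mono)
    fix z assume "z \<in> {..<D - 1}"
    then obtain b where b: "b < k" "\<forall>j<k. c j = z \<longrightarrow> bucket v b j"
      using greedy_cells[OF g, of z] by auto
    show "l / 24 * sum sc (Z z) \<le> skew_gap l (pmf (map_pmf f p) (z + 1)) (pmf (map_pmf f q) (z + 1))"
      unfolding pmf_f[OF supp(1)] pmf_f[OF supp(2)] l_def
      by (rule skew_gap_cell[OF sc _ _ M b(1)]) (use b in \<open>auto simp: Z_def\<close>)
  qed
  also have "\<dots> \<le> (\<Sum>z\<in>{..<D}. skew_gap l (pmf (map_pmf f p) (z + 1)) (pmf (map_pmf f q) (z + 1)))"
    using l by (intro sum_mono2) (auto intro!: skew_gap_nonneg)
  also have "\<dots> = (\<Sum>y\<in>{1..D}. skew_gap l (pmf (map_pmf f p) y) (pmf (map_pmf f q) y))"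
    by (rule sum.reindex_bij_witness[of _ "\<lambda>y. y - 1" "\<lambda>z. z + 1"]) auto
  also have "\<dots> = 1 - affinity l {1..D} (map_pmf f p) (map_pmf f q)"
    by (rule sum_skew_gap_pmf[OF _ supp_f supp_f]) (use supp in auto)
  finally show ?thesis by simp
qed

section \<open>Sample sizes\<close>

text \<open>Data processing for the affinity: Hoelder on the acceptance and on the rejection region
  replaces P and Q by the two-point laws of the decision.\<close>

lemma affinity_le_test:
  fixes P Q :: "'a list pmf" and \<phi> :: "'a list \<Rightarrow> hypothesis"
  assumes A: "finite A" "set_pmf P \<subseteq> A" "set_pmf Q \<subseteq> A" and l: "0 < l" "l < 1"
  defines "\<alpha> \<equiv> err_p P \<phi>" and "\<beta> \<equiv> err_q Q \<phi>"
  shows "affinity l A P Q \<le> (1 - \<alpha>) powr (1 - l) * \<beta> powr l + \<alpha> powr (1 - l) * (1 - \<beta>) powr l"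
proof -
  let ?B = "{x \<in> A. \<phi> x = Hyp_p}" and ?C = "{x \<in> A. \<phi> x \<noteq> Hyp_p}"
  have q_iff: "\<phi> x \<noteq> Hyp_q \<longleftrightarrow> \<phi> x = Hyp_p" for x by (cases "\<phi> x") auto
  have split: "sum f A = sum f ?B + sum f ?C" for f :: "'a list \<Rightarrow> real"
  proof -
    have "sum f (?B \<union> ?C) = sum f ?B + sum f ?C"
      using A(1) by (intro sum.union_disjoint) auto
    moreover have "?B \<union> ?C = A" by auto
    ultimately show ?thesis by simp
  qed
  have a: "sum (pmf P) ?C = \<alpha>"
    using A(1) unfolding \<alpha>_def err_p_def prob_finite_support[OF A(1,2)] by (simp add: sum.If_cases Int_def)
  have b: "sum (pmf Q) ?B = \<beta>"
    using A(1) unfolding \<beta>_def err_q_def prob_finite_support[OF A(1,3)] q_iff by (simp add: sum.If_cases Int_def)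
  have a': "sum (pmf P) ?B = 1 - \<alpha>" using split[of "pmf P"] a sum_pmf_eq_1[OF A(1,2)] by simp
  have b': "sum (pmf Q) ?C = 1 - \<beta>" using split[of "pmf Q"] b sum_pmf_eq_1[OF A(1,3)] by simp
  have "affinity l A P Q \<le> sum (pmf P) ?B powr (1 - l) * sum (pmf Q) ?B powr l
      + sum (pmf P) ?C powr (1 - l) * sum (pmf Q) ?C powr l"
    unfolding affinity_def split using A(1) l by (intro add_mono Holder_powr_sum) auto
  then show ?thesis unfolding a b a' b' .
qed

text \<open>A chord of the convex function on [0, 3/4], with exp(-3/2) <= 1/4 at the right end. The
  range is exactly what an affinity of at least 1/4 provides.\<close>

lemma exp_le_one_minus:
  fixes h :: real
  assumes "0 \<le> h" "h \<le> 3/4"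
  shows "exp (- 2 * h) \<le> 1 - h"
proof -
  have "exp (- 2 * h) = exp (- (3/2)) powr (4/3 * h)" by (simp add: powr_def)
  also have "\<dots> \<le> (1 - 4/3 * h) * 1 + 4/3 * h * exp (- (3/2))"
    using weighted_AM_GM[of 1 "exp (- (3/2))" "4/3 * h"] assms by simp
  also have "exp (- (3/2) :: real) \<le> 1/4"
  proof -
    have "(4::real) = 2 * 2" by simp
    also have "\<dots> \<le> exp (3/4) * exp (3/4)"
    proof -
      have "1 + 3/4 + (3/4)\<^sup>2 / 2 \<le> exp (3/4 :: real)" by (rule exp_lower_Taylor_quadratic) simp
      then have "2 \<le> exp (3/4 :: real)" by (simp add: power2_eq_square)
      then show ?thesis by (intro mult_mono) auto
    qed
    also have "\<dots> = exp (3/2 :: real)" by (simp flip: exp_add)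
    finally show ?thesis by (simp add: exp_minus field_simps)
  qed
  then have "(1 - 4/3 * h) * 1 + 4/3 * h * exp (- (3/2)) \<le> (1 - 4/3 * h) * 1 + 4/3 * h * (1/4)"
    using assms by (intro add_left_mono mult_left_mono) auto
  finally show ?thesis by simp
qed

text \<open>The assumption \<delta> < u^M stands in for minimality of M; divided by u, it reads
  \<pi> < u^(M-1). It drives the lower bound on n, and u^M <= \<pi> the upper bound.\<close>

locale testing_parameters =
  fixes \<pi> \<delta> u l :: real and M :: nat
  assumes pi: "0 < \<pi>" "\<pi> \<le> 1/2" and delta: "0 < \<delta>" "\<delta> < \<pi> / 4"
    and u_def: "u = \<delta> / \<pi>" and l_def: "l = 1 / (2 * real M)"
    and M: "1 \<le> M" "u ^ M \<le> \<pi>" "\<delta> < u ^ M"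
begin

lemma u: "0 < u" "u < 1/4" "\<pi> * u = \<delta>"
  using pi delta by (auto simp: u_def field_simps)

lemma l: "0 < l" "l \<le> 1/2" "l < 1" "l * real M = 1/2"
proof -
  show "0 < l" using M by (simp add: l_def)
  show "l \<le> 1/2" using M by (simp add: l_def field_simps)
  then show "l < 1" by linarith
  show "l * real M = 1/2" using M by (simp add: l_def)
qed

lemma delta_less: "\<delta> < (1/4) ^ M"
proof -
  have "u ^ M \<le> (1/4) ^ M" using u by (intro power_mono) auto
  then show ?thesis using M by linarith
qed

lemma pi_le: "\<pi> \<le> (1/4) ^ (M - 1)"
proof -
  obtain m where m: "M = Suc m" using M by (cases M) auto
  have "\<pi> * u < u ^ m * u" using M(3) u(3) m by (simp add: mult.commute)
  then have "\<pi> < u ^ m" using u(1) by simp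
  also have "\<dots> \<le> (1/4) ^ m" using u by (intro power_mono) auto
  finally show ?thesis using m by simp
qed

text \<open>\<delta> < 1/8 absorbs the factor 2 into \<delta>^(2/3), and \<delta> < u^M with l M =
  1/2 turns the l-th power into u^(2/3 * 1/2).\<close>

lemma beta_powr_le:
  assumes "0 \<le> b" "b \<le> 2 * \<delta>"
  shows "b powr l \<le> u powr (1/3)"
proof -
  have "\<delta> powr (1/3) \<le> (1/8) powr (1/3)" using delta pi by (intro powr_mono2) auto
  also have "(1/8 :: real) powr (1/3) = 1/2"
  proof -
    have "(1/2 :: real) powr 3 = (1/2) ^ 3" by (rule powr_numeral) simp
    then have "(1/8 :: real) = (1/2) powr 3" by (simp add: power_one_over)
    then show ?thesis by (simp only: powr_powr) simp
  qed
  finally have "\<delta> powr (2/3) * \<delta> powr (1/3) \<le> \<delta> powr (2/3) * (1/2)"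
    by (intro mult_left_mono) auto
  moreover have "\<delta> powr (2/3) * \<delta> powr (1/3) = \<delta>" using delta by (simp flip: powr_add)
  ultimately have "b \<le> \<delta> powr (2/3)" using assms by linarith
  also have "\<dots> \<le> (u ^ M) powr (2/3)" using M delta by (intro powr_mono2) auto
  finally have "b powr l \<le> ((u ^ M) powr (2/3)) powr l"
    using assms l by (intro powr_mono2) auto
  also have "\<dots> = u powr (2/3 * (l * real M))"
    using u by (simp only: powr_powr powr_realpow[symmetric]) (simp add: mult_ac)
  finally show ?thesis by (simp add: l(4))
qed

text \<open>
  For \<open>u\<close> bounded away from \<open>0\<close> only \<open>n * h \<ge> const\<close> is needed. The hypothesis on \<open>n_PF\<close> keeps
  \<open>h\<close> away from \<open>1\<close>, where \<open>- ln (1 - h)\<close> is no longer comparable to \<open>h\<close>.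
\<close>

lemma sample_size_lower:
  assumes A: "finite A" "set_pmf p \<subseteq> A" "set_pmf q \<subseteq> A" and PF: "n_PF p q (1/4) (1/4) \<ge> 2"
    and err: "bayes_err \<pi> (replicate_pmf n p) (replicate_pmf n q) \<phi> \<le> \<delta>"
  shows "ln (1 / u) \<le> 160 * (real n * (1 - affinity l A p q))"
proof -
  define h where "h = 1 - affinity l A p q"
  define \<alpha> \<beta> where "\<alpha> = err_p (replicate_pmf n p) \<phi>" and "\<beta> = err_q (replicate_pmf n q) \<phi>"
  have ab: "0 \<le> \<alpha>" "\<alpha> \<le> 1" "0 \<le> \<beta>" "\<beta> \<le> 1" by (auto simp: \<alpha>_def \<beta>_def err_p_def err_q_def)
  have sum: "\<pi> * \<alpha> + (1 - \<pi>) * \<beta> \<le> \<delta>" using err by (simp add: bayes_err_def \<alpha>_def \<beta>_def)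
  have \<alpha>u: "\<alpha> \<le> u"
  proof -
    have "0 \<le> (1 - \<pi>) * \<beta>" using pi ab by simp
    then have "\<pi> * \<alpha> \<le> \<delta>" using sum by linarith
    then show ?thesis using pi by (simp add: u_def field_simps)
  qed
  have \<beta>\<delta>: "\<beta> \<le> 2 * \<delta>"
  proof -
    have "0 \<le> \<pi> * \<alpha>" using pi ab by simp
    moreover have "1/2 * \<beta> \<le> (1 - \<pi>) * \<beta>" using pi ab by (intro mult_right_mono) auto
    ultimately show ?thesis using sum by linarith
  qed
  have h: "0 \<le> h" "h \<le> 3/4"
  proof -
    have "0 \<le> (\<Sum>x\<in>A. skew_gap l (pmf p x) (pmf q x))" using l by (intro sum_nonneg skew_gap_nonneg) auto
    then show "0 \<le> h" using sum_skew_gap_pmf[OF A] by (simp add: h_def)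
    show "h \<le> 3/4" using affinity_ge_of_n_PF[OF A PF, of l] l by (simp add: h_def)
  qed
  have "(1 - h) ^ n = affinity l (lists_len A n) (replicate_pmf n p) (replicate_pmf n q)"
    by (simp add: affinity_replicate[OF A(1)] h_def)
  also have "\<dots> \<le> (1 - \<alpha>) powr (1 - l) * \<beta> powr l + \<alpha> powr (1 - l) * (1 - \<beta>) powr l"
    unfolding \<alpha>_def \<beta>_def
    by (rule affinity_le_test[OF finite_lists_length_eq[OF A(1)] set_replicate_pmf_subset[OF A(2)]
          set_replicate_pmf_subset[OF A(3)] l(1,3)])
  finally have aff: "(1 - h) ^ n \<le> (1 - \<alpha>) powr (1 - l) * \<beta> powr l + \<alpha> powr (1 - l) * (1 - \<beta>) powr l" .
  have nh: "0 \<le> real n * h" using h by simp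
  have "ln (1 / u) \<le> 160 * (real n * h)"
  \<comment> \<open>Below 1/64 one has u^(1/6) <= 1/2, which absorbs the factor 2 in 2 u^(1/3). For
    larger u the logarithm is bounded, and a constant lower bound on n h is enough.\<close>
  proof (cases "u \<le> 1/64")
    case True
    have "(1 - \<alpha>) powr (1 - l) * \<beta> powr l \<le> 1 * u powr (1/3)"
      using ab l beta_powr_le[OF ab(3) \<beta>\<delta>] by (intro mult_mono powr_le1) auto
    moreover have "\<alpha> powr (1 - l) * (1 - \<beta>) powr l \<le> u powr (1/3) * 1"
    proof (intro mult_mono powr_le1)
      have "\<alpha> powr (1 - l) \<le> u powr (1 - l)" using ab \<alpha>u l by (intro powr_mono2) auto
      also have "\<dots> \<le> u powr (1/3)" using u l by (intro powr_mono') auto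
      finally show "\<alpha> powr (1 - l) \<le> u powr (1/3)" .
    qed (use ab l in auto)
    ultimately have "(1 - h) ^ n \<le> 2 * u powr (1/3)" using aff by linarith
    also have "\<dots> \<le> u powr (1/6)"
    proof -
      have "u powr (1/6) \<le> (1/64) powr (1/6)" using True u(1) by (intro powr_mono2) auto
      also have "(1/64 :: real) powr (1/6) = 1/2"
      proof -
        have "(1/2 :: real) powr 6 = (1/2) ^ 6" by (rule powr_numeral) simp
        then have "(1/64 :: real) = (1/2) powr 6" by (simp add: power_one_over)
        then show ?thesis by (simp only: powr_powr) simp
      qed
      finally have "u powr (1/6) * u powr (1/6) \<le> u powr (1/6) * (1/2)" by (intro mult_left_mono) auto
      moreover have "u powr (1/6) * u powr (1/6) = u powr (1/3)" by (simp flip: powr_add)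
      ultimately show ?thesis by linarith
    qed
    finally have 1: "(1 - h) ^ n \<le> u powr (1/6)" .
    have "exp (- 2 * h * real n) = exp (- 2 * h) ^ n" by (rule exp_of_nat2_mult)
    also have "\<dots> \<le> (1 - h) ^ n" using exp_le_one_minus[OF h] by (intro power_mono) auto
    also have "\<dots> \<le> exp (1/6 * ln u)"
    proof -
      have "u powr (1/6) = exp (1/6 * ln u)" using u(1) by (simp add: powr_def)
      then show ?thesis using 1 by (simp only:)
    qed
    finally have "exp (- 2 * h * real n) \<le> exp (1/6 * ln u)" .
    then have "- 2 * h * real n \<le> 1/6 * ln u" by (simp only: exp_le_cancel_iff)
    moreover have "ln (1 / u) = - ln u" using u(1) by (simp only: ln_divide_pos[OF zero_less_one] ln_one)
    ultimately have "ln (1 / u) \<le> 12 * (real n * h)" by (simp add: algebra_simps)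
    then show ?thesis using nh by linarith
  next
    case False
    \<comment> \<open>This makes the accepting outcome a point of level M. From \<delta> < 4^(-M)
      one gets 2^M (2 \<delta>) <= 2 sqrt \<delta> <= 3/4, while \<alpha> < 1/4. Its deficit is then
      (1 - \<alpha>)/24 >= 1/32, and with ln 64 <= 5 the constant is 160 = 5 * 32.\<close>
    have "2 ^ M * \<beta> \<le> 1 - \<alpha>"
    proof -
      have "sqrt \<delta> * 2 ^ M \<le> 1"
      proof -
        have "sqrt \<delta> \<le> sqrt ((1/4) ^ M)" using delta_less by (intro real_sqrt_le_mono) simp
        also have "\<dots> = (1/2) ^ M" by (simp add: real_sqrt_power real_sqrt_divide)
        finally show ?thesis by (simp add: power_one_over field_simps)
      qed
      then have "2 * sqrt \<delta> * (sqrt \<delta> * 2 ^ M) \<le> 2 * sqrt \<delta> * 1"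
        using delta by (intro mult_left_mono) auto
      moreover have "2 * sqrt \<delta> * (sqrt \<delta> * 2 ^ M) = 2 ^ M * (2 * (sqrt \<delta> * sqrt \<delta>))" by (simp only: mult_ac)
      moreover have "sqrt \<delta> * sqrt \<delta> = \<delta>" using delta by simp
      ultimately have "2 ^ M * (2 * \<delta>) \<le> 2 * sqrt \<delta>" by simp
      moreover have "sqrt \<delta> \<le> 3/8"
        using delta pi by (intro real_le_lsqrt) (auto simp: power2_eq_square)
      moreover have "2 ^ M * \<beta> \<le> 2 ^ M * (2 * \<delta>)" using \<beta>\<delta> by (intro mult_left_mono) auto
      ultimately show ?thesis using \<alpha>u u by linarith
    qed
    then have "l * (real M * (1 - \<alpha>)) / 12 \<le> skew_gap l (1 - \<alpha>) \<beta>"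
      unfolding l_def using ab M by (intro skew_gap_ge_level) auto
    moreover have "l * (real M * (1 - \<alpha>)) / 12 \<ge> 1/32"
    proof -
      have eq: "l * (real M * (1 - \<alpha>)) = 1/2 * (1 - \<alpha>)" by (simp only: mult.assoc[symmetric] l(4))
      show ?thesis unfolding eq using \<alpha>u u(2) by simp
    qed
    moreover have "0 \<le> skew_gap l \<alpha> (1 - \<beta>)" using ab l by (intro skew_gap_nonneg) auto
    moreover have "skew_gap l (1 - \<alpha>) \<beta> + skew_gap l \<alpha> (1 - \<beta>)
        = 1 - ((1 - \<alpha>) powr (1 - l) * \<beta> powr l + \<alpha> powr (1 - l) * (1 - \<beta>) powr l)"
      unfolding skew_gap_def by (simp add: algebra_simps)
    moreover have "1 - real n * h \<le> (1 - h) ^ n"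
      using Bernoulli_inequality[of "- h" n] h by simp
    ultimately have "1/32 \<le> real n * h" using aff by linarith
    moreover have "ln (1 / u) \<le> ln (2 ^ 6)"
      using False u(1) by (intro iffD2[OF ln_le_cancel_iff]) (auto simp: field_simps)
    moreover have "ln (2 ^ 6 :: real) \<le> 5" using ln2_le_25_over_36 by (simp only: ln_realpow)
    ultimately show ?thesis by linarith
  qed
  then show ?thesis by (simp add: h_def)
qed

text \<open>The factor 2 in the hypothesis yields u^2 in the Chernoff bound. One u pays for the
  missing \<pi>^l, because u <= u^(1/2) = (u^M)^l <= \<pi>^l; the other makes \<pi> u =
  \<delta>.\<close>

lemma sample_size_upper:
  assumes A: "finite A" "set_pmf p \<subseteq> A" "set_pmf q \<subseteq> A"
    and h: "affinity l A p q \<le> 1 - h" "2 * ln (1 / u) \<le> real n * h"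
  shows "n_B p q \<pi> \<delta> \<le> enat n"
proof -
  obtain \<phi> where "bayes_err \<pi> (replicate_pmf n p) (replicate_pmf n q) \<phi> \<le> \<pi> powr (1 - l) * affinity l A p q ^ n"
    using ex_test_Chernoff[OF A, of \<pi> l n] pi l by auto
  also have "\<dots> \<le> \<pi> powr (1 - l) * (u * u)"
  proof (intro mult_left_mono)
    have "affinity l A p q ^ n \<le> exp (- h) ^ n"
    proof (rule power_mono)
      show "affinity l A p q \<le> exp (- h)" using h(1) exp_ge_add_one_self[of "- h"] by linarith
      show "0 \<le> affinity l A p q" by (auto simp: affinity_def intro: sum_nonneg)
    qed
    also have "\<dots> = exp (- (real n * h))" by (simp flip: exp_of_nat_mult)
    also have "\<dots> \<le> exp (2 * ln u)"
    proof -
      have "ln (1 / u) = - ln u" using u(1) by (simp only: ln_divide_pos[OF zero_less_one] ln_one)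
      then show ?thesis using h(2) by (simp only: exp_le_cancel_iff)
    qed
    also have "\<dots> = u * u" using u(1) by (simp only: mult_2 exp_add exp_ln)
    finally show "affinity l A p q ^ n \<le> u * u" .
  qed simp
  also have "\<dots> = \<pi> powr (1 - l) * u * u" by simp
  also have "\<dots> \<le> \<pi> powr (1 - l) * \<pi> powr l * u"
  proof (intro mult_right_mono mult_left_mono)
    have "u powr 1 \<le> u powr (1/2)" using u by (intro powr_mono') auto
    also have "\<dots> = (u ^ M) powr l"
      using u(1) l(4) by (simp only: powr_powr powr_realpow[symmetric] mult.commute[of "real M"])
    also have "\<dots> \<le> \<pi> powr l" using M(2) l u(1) by (intro powr_mono2) auto
    finally show "u \<le> \<pi> powr l" using u(1) by simp
  qed (use u in auto)
  also have "\<dots> = \<delta>" using pi u(3) by (simp flip: powr_add)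
  finally show ?thesis by (rule n_B_le_enat)
qed

end

text \<open>The lower bound on n for (p, q) and the upper bound for the quantized pair contain the
  same ln(1/u), and l cancels between the score bounds on either side. Only the fraction of the gap
  that survives quantization remains.\<close>

lemma quantizer_sample_size:
  fixes p q :: "nat pmf"
  assumes supp: "set_pmf p \<subseteq> {..<k}" "set_pmf q \<subseteq> {..<k}" and PF: "n_PF p q (1/4) (1/4) \<ge> 2"
    and par: "testing_parameters \<pi> \<delta> u l M" and D: "D \<ge> 2"
    and sc: "\<And>j. j < k \<Longrightarrow> scored M (pmf p j) (pmf q j) (v j) (sc j)"
    and g: "greedy k D v sc (D - 1) c"
  shows "ereal_of_enat (n_B (map_pmf (\<lambda>x. c x + 1) p) (map_pmf (\<lambda>x. c x + 1) q) \<pi> \<delta>)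
     \<le> ereal 5000000 * comm_bound (n_B p q \<pi> \<delta>) \<pi> D"
proof (cases "n_B p q \<pi> \<delta>")
  case infinity
  then show ?thesis by (simp add: comm_bound_def)
next
  case (enat n)
  interpret testing_parameters \<pi> \<delta> u l M by (rule par)
  define h where "h = 1 - affinity l {..<k} p q"
  define X where "X = max 1 (ln (real n / \<pi>) / real D)"
  define S where "S = sum sc {..<k}"
  obtain \<phi> where "bayes_err \<pi> (replicate_pmf n p) (replicate_pmf n q) \<phi> \<le> \<delta>"
    using n_B_enatD[OF enat] by blast
  then have lower: "ln (1 / u) \<le> 160 * (real n * h)"
    unfolding h_def by (intro sample_size_lower[OF _ supp PF]) auto
  have "ln (4::real) \<le> ln (1 / u)"
    using u(1,2) by (intro iffD2[OF ln_le_cancel_iff]) (auto simp: field_simps)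
  moreover have "ln (4::real) = 2 * ln 2" using ln_realpow[of 2 2] by simp
  ultimately have ln_u: "4/3 \<le> ln (1 / u)" using ln2_ge_two_thirds by linarith
  have n0: "n \<noteq> 0" using lower ln_u by (intro notI) simp
  then have n: "1 \<le> real n" by simp
  have nh: "1/120 \<le> real n * h" using lower ln_u by linarith
  have h0: "0 < h"
  proof (rule ccontr)
    assume "\<not> 0 < h"
    then have "real n * h \<le> 0" by (intro mult_nonneg_nonpos) auto
    then show False using nh by simp
  qed
  have hS: "h \<le> 3 * l * S"
  proof -
    have "h = (\<Sum>j<k. skew_gap l (pmf p j) (pmf q j))"
      unfolding h_def by (rule sum_skew_gap_pmf[symmetric]) (use supp in auto)
    also have "\<dots> \<le> (\<Sum>j<k. 3 * l * sc j)"
      unfolding l_def by (intro sum_mono skew_gap_le_score[OF sc _ _ M(1)]) auto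
    finally show ?thesis by (simp only: S_def sum_distrib_left)
  qed
  have S0: "0 < S"
  proof (rule ccontr)
    assume "\<not> 0 < S"
    then have "3 * l * S \<le> 0" using l by (intro mult_nonneg_nonpos) auto
    then show False using hS h0 by linarith
  qed
  \<comment> \<open>ln(1/u) >= ln 4 >= 4/3 gives n h >= 1/120, and h <= (3/2) S gives n S >=
    1/180.\<close>
  have S: "1 / (200 * real n) \<le> S"
  proof -
    have "3 * l * S \<le> 3/2 * S" using l S0 by (intro mult_right_mono) auto
    then have "h \<le> 3/2 * S" using hS by linarith
    then have "real n * h \<le> real n * (3/2 * S)" by (intro mult_left_mono) auto
    then have "1 \<le> 200 * real n * S" using nh by linarith
    then show ?thesis using n by (simp add: field_simps)
  qed
  have X: "1 \<le> X" by (simp add: X_def)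
  have "S / (200 * X) \<le> (\<Sum>j<k. if c j < D - 1 then sc j else 0)"
    unfolding S_def X_def
    by (rule greedy_score_cover[OF g D sc supp M(1) pi_le pi n]) (use S in \<open>auto simp: S_def\<close>)
  then have "l / 24 * (S / (200 * X)) \<le> l / 24 * (\<Sum>j<k. if c j < D - 1 then sc j else 0)"
    using l by (intro mult_left_mono) auto
  \<comment> \<open>14400 = 3 * 24 * 200: score against gap, merging loss, and covering
    loss.\<close>
  moreover have "h / (14400 * X) \<le> l / 24 * (S / (200 * X))"
    using hS X by (simp add: field_simps)
  ultimately have aff: "affinity l {1..D} (map_pmf (\<lambda>x. c x + 1) p) (map_pmf (\<lambda>x. c x + 1) q) \<le> 1 - h / (14400 * X)"
    using affinity_map_le[OF g D sc supp M(1)] unfolding l_def by linarith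
  define n' where "n' = nat \<lceil>2 * ln (1 / u) / (h / (14400 * X))\<rceil>"
  have hX: "0 < h / (14400 * X)" using h0 X by simp
  have n'_ge: "2 * ln (1 / u) / (h / (14400 * X)) \<le> real n'" unfolding n'_def by (rule real_nat_ceiling_ge)
  then have "2 * ln (1 / u) \<le> real n' * (h / (14400 * X))" using hX by (simp only: pos_divide_le_eq)
  moreover have "c j < D" if "j < k" for j using greedy_labels[OF g that] D by auto
  then have "set_pmf (map_pmf (\<lambda>x. c x + 1) r) \<subseteq> {1..D}" if "set_pmf r \<subseteq> {..<k}" for r
    using that by (fastforce simp: Suc_le_eq)
  ultimately have upper: "n_B (map_pmf (\<lambda>x. c x + 1) p) (map_pmf (\<lambda>x. c x + 1) q) \<pi> \<delta> \<le> enat n'"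
    using supp aff by (intro sample_size_upper[of "{1..D}"]) auto
  have "real n' \<le> 2 * ln (1 / u) / (h / (14400 * X)) + 1"
  proof -
    have "0 \<le> 2 * ln (1 / u) / (h / (14400 * X))" using divide_nonneg_pos[OF _ hX, of "2 * ln (1 / u)"] ln_u by linarith
    then show ?thesis unfolding n'_def by linarith
  qed
  moreover have "2 * ln (1 / u) / (h / (14400 * X)) \<le> 2 * (160 * (real n * h)) / (h / (14400 * X))"
    using hX lower by (intro divide_right_mono) linarith+
  moreover have "2 * (160 * (real n * h)) / (h / (14400 * X)) = 4608000 * (real n * X)"
    using h0 X by (simp add: field_simps)
  moreover have "1 * 1 \<le> real n * X" using n X by (intro mult_mono) auto
  \<comment> \<open>The factor is 2 * 160 * 14400 = 4608000. The 1 from rounding up is absorbed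
    since n X >= 1.\<close>
  ultimately have "real n' \<le> 5000000 * (real n * X)" by linarith
  then have "ereal_of_enat (enat n') \<le> ereal 5000000 * comm_bound (n_B p q \<pi> \<delta>) \<pi> D"
    by (simp add: enat comm_bound_def X_def)
  moreover have "ereal_of_enat (n_B (map_pmf (\<lambda>x. c x + 1) p) (map_pmf (\<lambda>x. c x + 1) q) \<pi> \<delta>) \<le> ereal_of_enat (enat n')"
    using upper by (simp only: ereal_of_enat_le_iff)
  ultimately show ?thesis by (rule order_trans[rotated])
qed

text \<open>The cubic time comes from the greedy stage: D - 1 rounds, each computing k gains in O(k)
  steps. Its other stages are quadratic at most, the scoring because a level takes at most
  ln(1/\<delta>) steps.\<close>

lemma quantizer_prog_correct:
  fixes k D :: nat and p q :: "nat pmf" and \<pi> \<delta> :: real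
  assumes supp: "set_pmf p \<subseteq> {..<k}" "set_pmf q \<subseteq> {..<k}" and PF: "n_PF p q (1/4) (1/4) \<ge> 2"
    and \<pi>: "0 < \<pi>" "\<pi> \<le> 1/2" and \<delta>: "0 < \<delta>" "\<delta> < \<pi> / 4" and D: "D \<ge> 2"
  shows "\<exists>t s f. run quantizer_prog (input_store k p q \<pi> \<delta> D) t s \<and>
     real t \<le> 61 * (real k + real D + ln (1/\<pi>) + ln (1/\<delta>)) ^ 3 \<and>
     outputs_channel k D s f \<and>
     ereal_of_enat (n_B (bind_pmf p f) (bind_pmf q f) \<pi> \<delta>) \<le> ereal 5000000 * comm_bound (n_B p q \<pi> \<delta>) \<pi> D"
proof -
  define K where "K = nat \<lfloor>ln (1 / \<delta>)\<rfloor>"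
  have k: "0 < k" using supp(1) set_pmf_not_empty[of p] by (cases k) auto
  obtain t s M v sc c where r: "run quantizer_prog (input_store k p q \<pi> \<delta> D) t s"
    "t \<le> 11 + 3 * K + k * (17 + 3 * K) + (D - 1) * (8 + k * (14 + k * 5))"
    "1 \<le> M" "(\<delta> / \<pi>) ^ M \<le> \<pi>" "\<delta> < (\<delta> / \<pi>) ^ M"
    "\<forall>i<k. scored M (pmf p i) (pmf q i) (v i) (sc i)" "greedy k D v sc (D - 1) c"
    "\<forall>z. reals s ''f'' z = (if \<exists>x<k. z = x * D + c x then 1 else 0)"
    using quantizer_prog_spec[OF \<pi>(1) _ \<delta> k, of p q D] \<pi>(2) unfolding K_def by auto
  have cD: "c j < D" if "j < k" for j using greedy_labels[OF r(7) that] D by auto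
  have par: "testing_parameters \<pi> \<delta> (\<delta> / \<pi>) (1 / (2 * real M)) M"
    using \<pi> \<delta> r(3-5) by unfold_locales auto
  have "real t \<le> 61 * (real k + real D + ln (1/\<pi>) + ln (1/\<delta>)) ^ 3"
  proof -
    define B where "B = real k + real D + ln (1/\<pi>) + ln (1/\<delta>)"
    have pos: "0 \<le> ln (1/\<pi>)" "0 \<le> ln (1/\<delta>)" using \<pi> \<delta> by (auto intro!: ln_ge_zero simp: field_simps)
    then have K: "real K \<le> ln (1/\<delta>)" unfolding K_def by simp
    have B: "1 \<le> B" "real k \<le> B" "real D \<le> B" "real K \<le> B" using pos K k by (auto simp: B_def)
    have b1: "real K \<le> B ^ 3" "1 \<le> B ^ 3" "real k \<le> B ^ 3" "real D \<le> B ^ 3"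
      using B power_increasing[of 1 3 B] one_le_power[of B 3] by simp_all
    have b2: "real k * real K \<le> B ^ 3" "real D * real k \<le> B ^ 3"
    proof -
      have "B * B \<le> B ^ 3" using B power_increasing[of 2 3 B] by (simp add: power2_eq_square)
      moreover have "real k * real K \<le> B * B" "real D * real k \<le> B * B" using B by (auto intro!: mult_mono)
      ultimately show "real k * real K \<le> B ^ 3" "real D * real k \<le> B ^ 3" by linarith+
    qed
    have b3: "real D * (real k * real k) \<le> B ^ 3"
    proof -
      have "real D * (real k * real k) \<le> B * (B * B)" using B by (auto intro!: mult_mono)
      then show ?thesis by (simp add: power3_eq_cube mult.assoc)
    qed
    have "t \<le> 11 + 3 * K + k * (17 + 3 * K) + D * (8 + k * (14 + k * 5))"
      using r(2) mult_le_mono1[of "D - 1" D "8 + k * (14 + k * 5)"] by linarith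
    then have "real t \<le> real (11 + 3 * K + k * (17 + 3 * K) + D * (8 + k * (14 + k * 5)))"
      by (simp only: of_nat_le_iff)
    also have "\<dots> = 11 * 1 + 3 * real K + 17 * real k + 3 * (real k * real K) + 8 * real D + 14 * (real D * real k)
        + 5 * (real D * (real k * real k))" by (simp add: algebra_simps)
    \<comment> \<open>61 is the sum of the coefficients on the preceding line, each monomial being
      at most B^3.\<close>
    also have "\<dots> \<le> 61 * B ^ 3" using b1 b2 b3 by linarith
    finally show ?thesis by (simp add: B_def)
  qed
  moreover have "outputs_channel k D s (\<lambda>x. return_pmf (c x + 1))"
    by (rule quantizer_prog_output[OF r(8) cD])
  moreover have "ereal_of_enat (n_B (map_pmf (\<lambda>x. c x + 1) p) (map_pmf (\<lambda>x. c x + 1) q) \<pi> \<delta>)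
     \<le> ereal 5000000 * comm_bound (n_B p q \<pi> \<delta>) \<pi> D"
    using r(6) by (intro quantizer_sample_size[OF supp PF par D _ r(7)]) auto
  ultimately show ?thesis using r(1) unfolding map_pmf_def by blast
qed

text \<open>One deterministic quantizer serves both parts: being an admissible channel, it bounds
  the constrained sample complexity, and the program outputs it. The lower bound in the first part
  is data processing and holds with constant 1.\<close>

theorem theorem2p4:
  shows
    "(\<exists>C::real. C > 0 \<and>
        (\<forall>(k::nat) (p::nat pmf) (q::nat pmf) (\<pi>::real) (\<delta>::real) (D::nat).
           set_pmf p \<subseteq> {..<k} \<longrightarrow> set_pmf q \<subseteq> {..<k} \<longrightarrow>
           n_PF p q (1/4) (1/4) \<ge> 2 \<longrightarrow>
           0 < \<pi> \<longrightarrow> \<pi> \<le> 1/2 \<longrightarrow> 0 < \<delta> \<longrightarrow> \<delta> < \<pi>/4 \<longrightarrow> D \<ge> 2 \<longrightarrow>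
             ereal_of_enat (n_B p q \<pi> \<delta>)
               \<le> ereal C * ereal_of_enat (n_B_comm {..<k} p q \<pi> \<delta> D) \<and>
             ereal_of_enat (n_B_comm {..<k} p q \<pi> \<delta> D)
               \<le> ereal C * comm_bound (n_B p q \<pi> \<delta>) \<pi> D)) \<and>
     (\<exists>(C::real) (prog::program) (a::real) (d::nat). C > 0 \<and>
        (\<forall>(k::nat) (p::nat pmf) (q::nat pmf) (\<pi>::real) (\<delta>::real) (D::nat).
           set_pmf p \<subseteq> {..<k} \<longrightarrow> set_pmf q \<subseteq> {..<k} \<longrightarrow>
           n_PF p q (1/4) (1/4) \<ge> 2 \<longrightarrow>
           0 < \<pi> \<longrightarrow> \<pi> \<le> 1/2 \<longrightarrow> 0 < \<delta> \<longrightarrow> \<delta> < \<pi>/4 \<longrightarrow> D \<ge> 2 \<longrightarrow>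
             (\<exists>t s f.
                run prog (input_store k p q \<pi> \<delta> D) t s \<and>
                real t \<le> a * (real k + real D + ln (1/\<pi>) + ln (1/\<delta>)) ^ d \<and>
                outputs_channel k D s f \<and>
                ereal_of_enat (n_B (bind_pmf p f) (bind_pmf q f) \<pi> \<delta>)
                  \<le> ereal C * comm_bound (n_B p q \<pi> \<delta>) \<pi> D)))"
proof (rule conjI, goal_cases)
  case 1
  show ?case
  proof (intro exI[of _ 5000000] conjI allI impI)
    fix k D :: nat and p q :: "nat pmf" and \<pi> \<delta> :: real
    assume h: "set_pmf p \<subseteq> {..<k}" "set_pmf q \<subseteq> {..<k}" "n_PF p q (1/4) (1/4) \<ge> 2"
      "0 < \<pi>" "\<pi> \<le> 1/2" "0 < \<delta>" "\<delta> < \<pi>/4" "D \<ge> 2"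
    let ?m = "n_B_comm {..<k} p q \<pi> \<delta> D"
    have "ereal_of_enat (n_B p q \<pi> \<delta>) \<le> ereal_of_enat ?m"
      using n_B_le_n_B_comm[OF _ h(1,2)] h(4,5) by simp
    also have "\<dots> \<le> ereal 5000000 * ereal_of_enat ?m" by (cases ?m) auto
    finally show "ereal_of_enat (n_B p q \<pi> \<delta>) \<le> ereal 5000000 * ereal_of_enat ?m" .
    obtain f where f: "f \<in> channels {..<k} D"
      "ereal_of_enat (n_B (bind_pmf p f) (bind_pmf q f) \<pi> \<delta>) \<le> ereal 5000000 * comm_bound (n_B p q \<pi> \<delta>) \<pi> D"
      using quantizer_prog_correct[OF h] unfolding outputs_channel_def by blast
    have "ereal_of_enat ?m \<le> ereal_of_enat (n_B (bind_pmf p f) (bind_pmf q f) \<pi> \<delta>)"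
      using n_B_comm_le[OF f(1)] by simp
    then show "ereal_of_enat ?m \<le> ereal 5000000 * comm_bound (n_B p q \<pi> \<delta>) \<pi> D"
      using f(2) by (rule order_trans)
  qed simp
next
  case 2
  show ?case
  proof (rule exI[of _ 5000000], rule exI[of _ quantizer_prog], rule exI[of _ 61], rule exI[of _ 3],
      intro conjI allI impI)
    show "(0::real) < 5000000" by simp
  qed (rule quantizer_prog_correct)
qed

end
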